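(* Let $n\ge 2$ and let $s_1,\ldots,s_n\in\mathbb C$. The following are equivalent: (i) $(s_1,\ldots,s_n)$ is in the distinguished boundary $b\Gamma_n$ of $\Gamma_n$; (ii) $|s_n|=1$, $\bar s_n s_i=\bar s_{n-i}$ for $i=1,\ldots,n-1$, and $(\gamma_1s_1,\ldots,\gamma_{n-1}s_{n-1})\in\Gamma_{n-1}$, where $\gamma_i=\frac{n-i}{n}$ for $i=1,\ldots,n-1$; (iii) $(s_1,\ldots,s_n)\in\Gamma_n$ and $|s_n|=1$.
   Context: $\mathbb D$, $\overline{\mathbb D}$ and $\mathbb T$ denote the open unit disc, closed unit disc and unit circle in $\mathbb C$. For $n\ge 1$ the symmetrization map $\mathbf s:\mathbb C^n\to\mathbb C^n$ is $\mathbf s(z)=(s_1(z),\ldots,s_n(z))$, where $s_i(z_1,\ldots,z_n)=\sum_{1\le k_1<\cdots<k_i\le n}z_{k_1}\cdots z_{k_i}$ is the $i$-th elementary symmetric function. The symmetrized $n$-disc is $\Gamma_n:=\mathbf s(\overline{\mathbb D}^n)$. The distinguished boundary $b\Gamma_n$ is the Silov boundary of the algebra of functions continuous on $\Gamma_n$ and analytic in its interior; it is known that $b\Gamma_n=\mathbf s(\mathbb T^n)$. *)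

theory Defs
  imports "HOL-Analysis.Analysis"
begin

text \<open>
  A vector of \<open>\<complex>\<^sup>n\<close> is a function \<open>nat \<Rightarrow> complex\<close> that is extensional on \<open>{1..n}\<close>
  (so \<open>undefined\<close> outside), since dimensions \<open>n\<close> and \<open>n - 1\<close> occur together.
\<close>

definition Cn_topology :: "nat \<Rightarrow> (nat \<Rightarrow> complex) topology" where
  "Cn_topology n = product_topology (\<lambda>_. euclidean) {1..n}"

text \<open>The index tuples \<open>1 \<le> k\<^sub>1 < \<dots> < k\<^sub>i \<le> n\<close> are the subsets of \<open>{1..n}\<close> of size \<open>i\<close>.\<close>

definition elem_sym :: "nat \<Rightarrow> nat \<Rightarrow> (nat \<Rightarrow> complex) \<Rightarrow> complex" where
  "elem_sym n i z = (\<Sum>K | K \<subseteq> {1..n} \<and> card K = i. \<Prod>k\<in>K. z k)"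

definition symmetrization :: "nat \<Rightarrow> (nat \<Rightarrow> complex) \<Rightarrow> (nat \<Rightarrow> complex)" where
  "symmetrization n z = (\<lambda>i\<in>{1..n}. elem_sym n i z)"

definition sym_disc :: "nat \<Rightarrow> (nat \<Rightarrow> complex) set" where
  "sym_disc n = symmetrization n ` ({1..n} \<rightarrow>\<^sub>E cball 0 1)"

text \<open>
  Complex (Frechet) differentiability at a point of \<open>\<complex>\<^sup>n\<close>: the remainder of a
  \<open>\<complex>\<close>-linear approximation is little-o of the Euclidean distance. A function is analytic
  on an open subset of \<open>\<complex>\<^sup>n\<close> if this holds at each of its points. It is stated by hand
  because \<open>nat \<Rightarrow> complex\<close> is not a normed space.
\<close>

definition complex_differentiable_at ::
  "nat \<Rightarrow> ((nat \<Rightarrow> complex) \<Rightarrow> complex) \<Rightarrow> (nat \<Rightarrow> complex) \<Rightarrow> bool" where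
  "complex_differentiable_at n f z \<longleftrightarrow>
     (\<exists>c :: nat \<Rightarrow> complex.
        ((\<lambda>w. (f w - f z - (\<Sum>i=1..n. c i * (w i - z i))) /
               of_real (L2_set (\<lambda>i. cmod (w i - z i)) {1..n})) \<longlongrightarrow> 0)
          (atin (Cn_topology n) z))"

definition analytic_on_Cn ::
  "nat \<Rightarrow> ((nat \<Rightarrow> complex) \<Rightarrow> complex) \<Rightarrow> (nat \<Rightarrow> complex) set \<Rightarrow> bool" where
  "analytic_on_Cn n f U \<longleftrightarrow> (\<forall>z\<in>U. complex_differentiable_at n f z)"

definition sym_disc_algebra :: "nat \<Rightarrow> ((nat \<Rightarrow> complex) \<Rightarrow> complex) set" where
  "sym_disc_algebra n =
     {f. continuous_map (subtopology (Cn_topology n) (sym_disc n)) euclidean f \<and>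
         analytic_on_Cn n f (Cn_topology n interior_of sym_disc n)}"

text \<open>
  A closed boundary for a family \<open>A\<close> of functions on a (compact) space \<open>X\<close> is a closed set
  on which the modulus of each member attains its maximum over \<open>X\<close>. The Shilov boundary is
  the smallest one.
\<close>

definition closed_boundary :: "'a topology \<Rightarrow> ('a \<Rightarrow> complex) set \<Rightarrow> 'a set \<Rightarrow> bool" where
  "closed_boundary X A K \<longleftrightarrow>
     closedin X K \<and> (\<forall>f\<in>A. \<forall>x\<in>topspace X. \<exists>k\<in>K. cmod (f x) \<le> cmod (f k))"

definition shilov_boundary :: "'a topology \<Rightarrow> ('a \<Rightarrow> complex) set \<Rightarrow> 'a set" where
  "shilov_boundary X A = (LEAST K. closed_boundary X A K)"

definition sym_disc_boundary :: "nat \<Rightarrow> (nat \<Rightarrow> complex) set" where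
  "sym_disc_boundary n =
     shilov_boundary (subtopology (Cn_topology n) (sym_disc n)) (sym_disc_algebra n)"

end

theory Submission
  imports Defs "HOL-Complex_Analysis.Conformal_Mappings"
    "HOL-Computational_Algebra.Fundamental_Theorem_Algebra"
begin

text \<open>
  Attach to \<open>s\<close> the monic polynomial \<open>P\<close> whose roots have elementary symmetric functions
  \<open>s\<^sub>1, \<dots>, s\<^sub>n\<close>. Then \<open>s\<close> lies in the symmetrized disc iff all roots of \<open>P\<close> lie in the closed
  disc (\<open>in_symmetrization_image_iff\<close>), and the point in condition (ii) belongs in the same way to
  \<open>P' / n\<close>. All three conditions turn out to describe the symmetrized torus, where the roots
  lie on the circle.

  For (iii) this holds because \<open>s\<^sub>n\<close> is the product of the roots. For (ii), roots on the circle
  give the symmetry of the coefficients by complementing index sets, and put the roots of \<open>P'\<close> in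
  the disc by Gauss and Lucas. Conversely the symmetry says that \<open>P\<close> is self-inversive, and
  then \<open>P = x Q \<plusminus> s\<^sub>n Q\<^sup>*\<close> with \<open>Q = P' / n\<close> and its conjugate reciprocal \<open>Q\<^sup>*\<close>
  (\<open>cohn_identity\<close>). If \<open>Q\<close> has its roots in the disc, then \<open>|Q\<^sup>*| \<le> |Q|\<close> outside, so the first
  term dominates there and \<open>P\<close> has no root outside the disc; as the product of the roots has
  modulus 1, all of them are on the circle.

  It remains to see that the Shilov boundary is the symmetrized torus. It is a closed boundary
  (\<open>maximum_modulus_on_torus\<close>): through each point of the open polydisc runs an analytic disc, made of
  Blaschke factors, whose boundary lies in the torus, and the symmetrization maps the open polydisc
  into the interior, so that the maximum principle in one variable applies.

  It is contained in every closed boundary (\<open>sym_torus_subset_closed_boundary\<close>). The function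
  \<open>\<Prod>\<^sub>j (z\<^sub>j\<^sup>N + 1) / 2\<close> is a polynomial in the elementary symmetric functions whose modulus on the closed
  polydisc has its maximum 1 exactly at the finitely many points that come from tuples of \<open>N\<close>-th roots of
  unity. A high power of it, times a polynomial that vanishes at all but one of these points, forces a
  closed boundary to contain the remaining one. These points are dense in the symmetrized torus.
\<close>

section \<open>Points of the symmetrized disc as polynomials with restricted roots\<close>

text \<open>
  The monic polynomial \<open>x\<^sup>n - s\<^sub>1 x\<^bsup>n-1\<^esup> + \<dots> + (-1)\<^sup>n s\<^sub>n\<close>, that is, the one whose roots have
  \<open>s\<^sub>1, \<dots>, s\<^sub>n\<close> as elementary symmetric functions. Membership of \<open>s\<close> in the symmetrized
  disc becomes a question about the location of these roots.
\<close>

definition root_poly :: "nat \<Rightarrow> (nat \<Rightarrow> complex) \<Rightarrow> complex \<Rightarrow> complex" where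
  "root_poly n s x = x ^ n + (\<Sum>i=1..n. (- 1) ^ i * s i * x ^ (n - i))"

text \<open>
  With the convention \<open>s\<^sub>0 = 1\<close> the leading term joins the sum, which makes the index reversal
  \<open>i \<mapsto> n - i\<close> available.
\<close>

lemma root_poly_altdef:
  "root_poly n s x = (\<Sum>i\<le>n. (- 1) ^ i * (if i = 0 then 1 else s i) * x ^ (n - i))"
proof -
  have "{..n} = insert 0 {1..n}" by auto
  then show ?thesis unfolding root_poly_def by (auto intro!: sum.cong)
qed

lemma elem_sym_0 [simp]: "elem_sym n 0 z = 1"
proof -
  have "{K. K \<subseteq> {1..n} \<and> card K = 0} = {{}}"
    using finite_subset[OF _ finite_atLeastAtMost[of 1 n]] by auto
  then show ?thesis by (simp add: elem_sym_def)
qed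

lemma elem_sym_self: "elem_sym n n z = (\<Prod>k\<in>{1..n}. z k)"
proof -
  have "{K. K \<subseteq> {1..n} \<and> card K = n} = {{1..n}}"
    using card_subset_eq[of "{1..n}"] by auto
  then show ?thesis by (simp add: elem_sym_def)
qed

text \<open>
  Vieta: expanding the product chooses \<open>- z\<^sub>j\<close> on a subset \<open>K\<close> of the indices and \<open>x\<close> on the
  others; grouping by \<open>card K\<close> gives the coefficients.
\<close>

lemma root_poly_symmetrization:
  "root_poly n (symmetrization n z) x = (\<Prod>j\<in>{1..n}. x - z j)"
proof -
  have "(\<Prod>j\<in>{1..n}. x - z j) = (\<Prod>j\<in>{1..n}. - z j + x)" by simp
  also have "\<dots> = (\<Sum>K\<in>Pow {1..n}. (\<Prod>j\<in>K. - z j) * (\<Prod>j\<in>{1..n}-K. x))"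
    by (rule prod_add) simp
  also have "\<dots> = (\<Sum>K\<in>Pow {1..n}. (- 1) ^ card K * (\<Prod>j\<in>K. z j) * x ^ (n - card K))"
  proof (rule sum.cong[OF refl])
    fix K assume "K \<in> Pow {1..n}"
    then have "card ({1..n} - K) = n - card K"
      using card_Diff_subset[of K "{1..n}"] finite_subset[of K "{1..n}"] by simp
    then show "(\<Prod>j\<in>K. - z j) * (\<Prod>j\<in>{1..n}-K. x)
        = (- 1) ^ card K * (\<Prod>j\<in>K. z j) * x ^ (n - card K)"
      by (simp add: prod_uminus)
  qed
  also have "\<dots> = (\<Sum>i\<le>n. \<Sum>K | K \<in> Pow {1..n} \<and> card K = i.
      (- 1) ^ card K * (\<Prod>j\<in>K. z j) * x ^ (n - card K))"
  proof (rule sum.group[symmetric])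
    show "card ` Pow {1..n} \<subseteq> {..n}"
      using card_mono[of "{1..n}"] by auto
  qed auto
  also have "\<dots> = (\<Sum>i\<le>n. (- 1) ^ i * elem_sym n i z * x ^ (n - i))"
    by (auto simp: elem_sym_def sum_distrib_left sum_distrib_right intro!: sum.cong)
  also have "\<dots> = root_poly n (symmetrization n z) x"
    unfolding root_poly_altdef by (auto simp: symmetrization_def intro!: sum.cong)
  finally show ?thesis ..
qed

lemma root_poly_inj:
  assumes "\<And>x. root_poly n s x = root_poly n t x"
  shows "restrict s {1..n} = restrict t {1..n}"
proof -
  have "s i = t i" if i: "i \<in> {1..n}" for i
  proof -
    define c where "c k = (- 1) ^ (n - k) *
      ((if n - k = 0 then 1 else s (n - k)) - (if n - k = 0 then 1 else t (n - k)))" for k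
    have "(\<Sum>k\<le>n. c k * x ^ k) = 0" for x
    proof -
      have "(\<Sum>k\<le>n. c k * x ^ k) = (\<Sum>i\<le>n. c (n - i) * x ^ (n - i))"
        by (rule sum.reindex_bij_witness[of _ "\<lambda>i. n - i" "\<lambda>i. n - i"]) auto
      also have "\<dots> = root_poly n s x - root_poly n t x"
        unfolding root_poly_altdef sum_subtractf[symmetric] c_def
        by (intro sum.cong refl) (auto simp: algebra_simps)
      finally show ?thesis using assms by simp
    qed
    then have "c (n - i) = 0" using polyfun_eq_0[of c n] i by auto
    moreover have "n - (n - i) = i" "i \<noteq> 0" using i by auto
    ultimately show "s i = t i" by (simp add: c_def)
  qed
  then show ?thesis by (auto simp: restrict_def)
qed

lemma root_poly_splits:
  obtains z where "z \<in> extensional {1..n}" "\<And>x. root_poly n s x = (\<Prod>j\<in>{1..n}. x - z j)"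
proof -
  define p where "p = monom 1 n + (\<Sum>i=1..n. monom ((- 1) ^ i * s i) (n - i))"
  have poly_p: "poly p x = root_poly n s x" for x
    by (simp add: p_def root_poly_def poly_sum poly_monom)
  have "coeff p k = (if k = n then 1 else 0)" if "k \<ge> n" for k
    using that by (auto simp: p_def coeff_sum intro!: sum.neutral)
  then have "coeff p n = 1" "\<And>k. k > n \<Longrightarrow> coeff p k = 0" by auto
  then have deg: "degree p = n"
    by (intro antisym degree_le le_degree) auto
  have lead: "lead_coeff p = 1" using deg \<open>coeff p n = 1\<close> by simp
  then have "p \<noteq> 0" by auto
  then obtain A where A: "size A = n" "p = (\<Prod>x\<in>#A. [:-x, 1:])"
    using alg_closed_imp_factorization[of p] deg lead by auto
  obtain xs where xs: "mset xs = A" using ex_mset by blast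
  define z where "z = restrict (\<lambda>j. xs ! (j - 1)) {1..n}"
  have "length xs = n" using A(1) xs by auto
  have "root_poly n s x = (\<Prod>j\<in>{1..n}. x - z j)" for x
  proof -
    have "root_poly n s x = (\<Prod>y\<in>#mset xs. x - y)"
      unfolding poly_p[symmetric] A(2) poly_prod_mset xs by (simp add: algebra_simps)
    also have "\<dots> = prod_list (map (\<lambda>y. x - y) xs)"
      by (simp flip: mset_map prod_mset_prod_list)
    also have "\<dots> = (\<Prod>i<n. x - xs ! i)"
      using \<open>length xs = n\<close> by (simp add: prod.list_conv_set_nth atLeast0LessThan)
    also have "\<dots> = (\<Prod>j\<in>{1..n}. x - z j)"
      by (rule prod.reindex_bij_witness[of _ "\<lambda>j. j - 1" Suc]) (auto simp: z_def)
    finally show ?thesis .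
  qed
  then show ?thesis using that[of z] by (auto simp: z_def)
qed

lemma root_poly_restrict [simp]: "root_poly n (restrict s {1..n}) = root_poly n s"
  by (auto simp: root_poly_def fun_eq_iff intro!: sum.cong)

text \<open>
  Over the complex numbers every monic polynomial splits, and its coefficients determine the
  coordinates. So membership in the image of \<open>A\<^sup>n\<close>, whatever \<open>A\<close> is, says that all roots lie
  in \<open>A\<close>.
\<close>

lemma in_symmetrization_image_iff:
  "restrict s {1..n} \<in> symmetrization n ` ({1..n} \<rightarrow>\<^sub>E A) \<longleftrightarrow>
     (\<forall>x. root_poly n s x = 0 \<longrightarrow> x \<in> A)"
proof
  assume "restrict s {1..n} \<in> symmetrization n ` ({1..n} \<rightarrow>\<^sub>E A)"
  then obtain z where z: "z \<in> {1..n} \<rightarrow>\<^sub>E A" "restrict s {1..n} = symmetrization n z" by auto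
  have "root_poly n s x = (\<Prod>j\<in>{1..n}. x - z j)" for x
    using root_poly_symmetrization[of n z x] unfolding z(2)[symmetric] root_poly_restrict .
  then show "\<forall>x. root_poly n s x = 0 \<longrightarrow> x \<in> A" using z(1) by auto
next
  assume *: "\<forall>x. root_poly n s x = 0 \<longrightarrow> x \<in> A"
  obtain z where z: "z \<in> extensional {1..n}"
    "\<And>x. root_poly n s x = (\<Prod>j\<in>{1..n}. x - z j)" using root_poly_splits[of n s] by metis
  have "root_poly n s (z j) = 0" if "j \<in> {1..n}" for j
    unfolding z(2) using that by (intro prod_zero) auto
  then have "z \<in> {1..n} \<rightarrow>\<^sub>E A" using * z(1) by (auto simp: PiE_iff)
  moreover have "restrict s {1..n} = restrict (symmetrization n z) {1..n}"
    by (rule root_poly_inj) (simp only: z(2) root_poly_symmetrization)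
  moreover have "restrict (symmetrization n z) {1..n} = symmetrization n z"
    by (simp add: symmetrization_def)
  ultimately show "restrict s {1..n} \<in> symmetrization n ` ({1..n} \<rightarrow>\<^sub>E A)"
    by (intro image_eqI[of _ _ z]) simp_all
qed

lemma sym_disc_iff:
  "restrict s {1..n} \<in> sym_disc n \<longleftrightarrow> (\<forall>x. root_poly n s x = 0 \<longrightarrow> cmod x \<le> 1)"
  unfolding sym_disc_def in_symmetrization_image_iff by simp

definition sym_torus :: "nat \<Rightarrow> (nat \<Rightarrow> complex) set" where
  "sym_torus n = symmetrization n ` ({1..n} \<rightarrow>\<^sub>E sphere 0 1)"

text \<open>
  The last coordinate is the product of the \<open>z\<^sub>j\<close>; numbers of modulus at most 1 have a product of
  modulus 1 only if each of them has modulus 1.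
\<close>

lemma sym_torus_iff_sym_disc:
  assumes "n \<ge> 1"
  shows "restrict s {1..n} \<in> sym_torus n \<longleftrightarrow>
    restrict s {1..n} \<in> sym_disc n \<and> cmod (s n) = 1"
proof -
  have *: "s n = (\<Prod>k\<in>{1..n}. z k)" if "restrict s {1..n} = symmetrization n z" for z
    using fun_cong[OF that, of n] assms by (simp add: symmetrization_def elem_sym_self)
  show ?thesis
  proof
    assume "restrict s {1..n} \<in> sym_torus n"
    then obtain z where z: "z \<in> {1..n} \<rightarrow>\<^sub>E sphere 0 1" "restrict s {1..n} = symmetrization n z"
      by (auto simp: sym_torus_def)
    have "z \<in> {1..n} \<rightarrow>\<^sub>E cball 0 1" using z(1) by (simp add: PiE_iff)
    moreover have "cmod (s n) = 1"
      unfolding *[OF z(2)] prod_norm[symmetric] using z(1) by (intro prod.neutral) auto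
    ultimately show "restrict s {1..n} \<in> sym_disc n \<and> cmod (s n) = 1"
      using z(2) by (auto simp: sym_disc_def)
  next
    assume "restrict s {1..n} \<in> sym_disc n \<and> cmod (s n) = 1"
    then obtain z where z: "z \<in> {1..n} \<rightarrow>\<^sub>E cball 0 1" "restrict s {1..n} = symmetrization n z"
      and "cmod (s n) = 1"
      by (auto simp: sym_disc_def)
    have "cmod (z j) = 1" if j: "j \<in> {1..n}" for j
    proof -
      have "1 = cmod (z j) * (\<Prod>k\<in>{1..n} - {j}. cmod (z k))"
        using \<open>cmod (s n) = 1\<close> unfolding *[OF z(2)] prod_norm[symmetric]
        by (subst (asm) prod.remove[OF _ j]) auto
      also have "\<dots> \<le> cmod (z j) * 1"
        using z(1) by (intro mult_left_mono prod_le_1) (auto simp: PiE_iff)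
      finally have "1 \<le> cmod (z j)" by simp
      moreover have "cmod (z j) \<le> 1" using z(1) j by (simp add: PiE_iff)
      ultimately show ?thesis by simp
    qed
    then have "z \<in> {1..n} \<rightarrow>\<^sub>E sphere 0 1" using z(1) by (auto simp: PiE_iff)
    then show "restrict s {1..n} \<in> sym_torus n" using z(2) by (auto simp: sym_torus_def)
  qed
qed

section \<open>Critical points and self-inversive polynomials\<close>

text \<open>
  The roots of its root polynomial are the critical points of that of \<open>s\<close>; see
  \<open>root_poly_has_derivative\<close>.
\<close>

definition derived :: "nat \<Rightarrow> (nat \<Rightarrow> complex) \<Rightarrow> nat \<Rightarrow> complex" where
  "derived n s = (\<lambda>i\<in>{1..n-1}. (of_nat (n - i) / of_nat n) * s i)"

lemma root_poly_has_derivative: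
  assumes "n \<ge> 1"
  shows "(root_poly n s has_field_derivative of_nat n * root_poly (n - 1) (derived n s) x) (at x)"
proof -
  have "(root_poly n s has_field_derivative
      of_nat n * x ^ (n - 1) + (\<Sum>i=1..n. (- 1) ^ i * s i * (of_nat (n - i) * x ^ (n - i - 1)))) (at x)"
    unfolding root_poly_def by (auto intro!: derivative_eq_intros sum.cong)
  also have "(\<Sum>i=1..n. (- 1) ^ i * s i * (of_nat (n - i) * x ^ (n - i - 1)))
      = (\<Sum>i=1..n-1. (- 1) ^ i * s i * (of_nat (n - i) * x ^ (n - i - 1)))"
    by (rule sum.mono_neutral_right) auto
  also have "\<dots> = of_nat n * (\<Sum>i=1..n-1. (- 1) ^ i * derived n s i * x ^ (n - 1 - i))"
    unfolding sum_distrib_left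
    using assms by (intro sum.cong refl) (simp add: derived_def diff_commute)
  also have "of_nat n * x ^ (n - 1) + \<dots> = of_nat n * root_poly (n - 1) (derived n s) x"
    by (simp only: root_poly_def distrib_left)
  finally show ?thesis .
qed

text \<open>
  Geometrically: seen from \<open>x\<close> outside the disc, every vector \<open>x - w\<close> makes an acute angle
  with \<open>x\<close>.
\<close>

lemma Re_outside_disc:
  assumes "cmod w \<le> 1" "cmod x > 1"
  shows "Re (x / (x - w)) > 0"
proof -
  have "Re (cnj w * x) \<le> cmod (cnj w * x)" by (rule complex_Re_le_cmod)
  also have "\<dots> \<le> cmod x" using assms by (simp add: norm_mult mult_left_le_one_le)
  also have "\<dots> < cmod x * cmod x"
    using mult_strict_right_mono[of 1 "cmod x" "cmod x"] assms(2) by linarith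
  also have "\<dots> = Re (cnj x * x)"
    by (metis complex_norm_square mult.commute power2_eq_square Re_complex_of_real)
  finally have "Re (x * cnj (x - w)) > 0" by (simp add: algebra_simps)
  moreover have "x \<noteq> w" using assms by auto
  ultimately show ?thesis
    by (subst complex_div_cnj) (simp add: zero_less_divide_iff)
qed

text \<open>
  Gauss and Lucas for the disc: at a point \<open>x\<close> outside, the logarithmic derivative times \<open>x\<close> is
  \<open>\<Sum> x / (x - z\<^sub>j)\<close>, a sum of numbers with positive real part, so the derivative does not
  vanish there.
\<close>

lemma derived_in_sym_disc:
  assumes "n \<ge> 1" "restrict s {1..n} \<in> sym_disc n"
  shows "derived n s \<in> sym_disc (n - 1)"
proof -
  have "cmod x \<le> 1" if x: "root_poly (n - 1) (derived n s) x = 0" for x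
  proof (rule ccontr)
    assume "\<not> cmod x \<le> 1"
    then have gt: "cmod x > 1" by simp
    obtain z where z: "\<And>x. root_poly n s x = (\<Prod>j\<in>{1..n}. x - z j)"
      using root_poly_splits[of n s] by metis
    have "root_poly n s (z j) = 0" if "j \<in> {1..n}" for j
      unfolding z using that by (intro prod_zero) auto
    then have z1: "cmod (z j) \<le> 1" if "j \<in> {1..n}" for j
      using assms(2) that unfolding sym_disc_iff by blast
    then have ne: "x - z j \<noteq> 0" if "j \<in> {1..n}" for j using gt that by force
    have "(root_poly n s has_field_derivative
        (\<Prod>j\<in>{1..n}. x - z j) * (\<Sum>j\<in>{1..n}. 1 / (x - z j))) (at x)"
      unfolding z[abs_def]
      by (rule has_field_derivative_prod'[THEN DERIV_cong])
         (use ne in \<open>auto intro!: derivative_eq_intros\<close>)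
    then have "(\<Prod>j\<in>{1..n}. x - z j) * (\<Sum>j\<in>{1..n}. 1 / (x - z j)) = 0"
      using DERIV_unique[OF _ root_poly_has_derivative[OF assms(1)]] x by fastforce
    then have "(\<Sum>j\<in>{1..n}. 1 / (x - z j)) = 0" using ne by auto
    then have "Re (\<Sum>j\<in>{1..n}. x / (x - z j)) = 0"
      by (metis (no_types, lifting) mult.right_neutral mult_zero_right sum.cong sum_distrib_left
          times_divide_eq_right zero_complex.sel(1))
    moreover have "(\<Sum>j\<in>{1..n}. Re (x / (x - z j))) > 0"
      using assms(1) z1 gt by (intro sum_pos Re_outside_disc) auto
    ultimately show False by simp
  qed
  then have "restrict (derived n s) {1..n-1} \<in> sym_disc (n - 1)"
    unfolding sym_disc_iff by blast
  then show ?thesis by (simp add: derived_def)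
qed

text \<open>
  On the torus, multiplying \<open>\<Prod>\<^bsub>k\<in>K\<^esub> z\<^sub>k\<close> by the conjugate of the full product leaves the conjugate of
  the product over the complement of \<open>K\<close>. Complementation exchanges the subsets of size \<open>i\<close> with
  those of size \<open>n - i\<close>.
\<close>

lemma elem_sym_reflect:
  assumes "z \<in> {1..n} \<rightarrow> sphere 0 1" "i \<le> n"
  shows "cnj (elem_sym n n z) * elem_sym n i z = cnj (elem_sym n (n - i) z)"
proof -
  have unit: "cnj (z k) * z k = 1" if "k \<in> {1..n}" for k
    using assms(1) that complex_norm_square[of "z k"] by (simp add: Pi_iff mult.commute)
  have "cnj (elem_sym n n z) * elem_sym n i z =
      (\<Sum>K | K \<subseteq> {1..n} \<and> card K = i. (\<Prod>k\<in>{1..n}. cnj (z k)) * (\<Prod>k\<in>K. z k))"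
    unfolding elem_sym_self by (simp add: elem_sym_def sum_distrib_left)
  also have "\<dots> = (\<Sum>K | K \<subseteq> {1..n} \<and> card K = i. \<Prod>k\<in>{1..n} - K. cnj (z k))"
  proof (rule sum.cong[OF refl])
    fix K assume "K \<in> {K. K \<subseteq> {1..n} \<and> card K = i}"
    then have K: "K \<subseteq> {1..n}" by simp
    have "(\<Prod>k\<in>{1..n}. cnj (z k)) * (\<Prod>k\<in>K. z k)
        = (\<Prod>k\<in>{1..n} - K. cnj (z k)) * (\<Prod>k\<in>K. cnj (z k) * z k)"
      by (subst prod.subset_diff[OF K]) (simp_all add: prod.distrib mult.assoc)
    also have "(\<Prod>k\<in>K. cnj (z k) * z k) = 1"
      using K unit by (intro prod.neutral) auto
    finally show "(\<Prod>k\<in>{1..n}. cnj (z k)) * (\<Prod>k\<in>K. z k) = (\<Prod>k\<in>{1..n} - K. cnj (z k))"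
      by simp
  qed
  also have "\<dots> = (\<Sum>K | K \<subseteq> {1..n} \<and> card K = n - i. \<Prod>k\<in>K. cnj (z k))"
  proof (rule sum.reindex_bij_witness[of _ "\<lambda>K. {1..n} - K" "\<lambda>K. {1..n} - K"])
    have card_compl: "card ({1..n} - K) = n - card K" if "K \<subseteq> {1..n}" for K
      using that card_Diff_subset[of K "{1..n}"] finite_subset[of K "{1..n}"] by simp
    then show "{1..n} - K \<in> {K. K \<subseteq> {1..n} \<and> card K = n - i}"
      if "K \<in> {K. K \<subseteq> {1..n} \<and> card K = i}" for K
      using that by auto
    show "{1..n} - K \<in> {K. K \<subseteq> {1..n} \<and> card K = i}"
      if "K \<in> {K. K \<subseteq> {1..n} \<and> card K = n - i}" for K
      using that assms(2) card_compl[of K] by auto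
  qed (auto simp: double_diff)
  also have "\<dots> = cnj (elem_sym n (n - i) z)"
    by (simp add: elem_sym_def)
  finally show ?thesis .
qed

text \<open>
  The conjugate reciprocal polynomial \<open>x\<^sup>m\<close> times the conjugate of \<open>p (1 / cnj x)\<close> carries the conjugated
  coefficients in reverse order.
\<close>

lemma root_poly_reciprocal:
  assumes "x \<noteq> 0"
  shows "(\<Sum>i\<le>m. (- 1) ^ i * cnj (if i = 0 then 1 else s i) * x ^ i) =
    x ^ m * cnj (root_poly m s (1 / cnj x))"
  unfolding root_poly_altdef sum_distrib_left cnj_sum
proof (intro sum.cong refl)
  fix i assume "i \<in> {..m}"
  then have "x ^ m = x ^ i * x ^ (m - i)" by (simp flip: power_add)
  then show "(- 1) ^ i * cnj (if i = 0 then 1 else s i) * x ^ i =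
      x ^ m * cnj ((- 1) ^ i * (if i = 0 then 1 else s i) * (1 / cnj x) ^ (m - i))"
    using assms by (simp add: power_one_over)
qed

text \<open>
  Write \<open>P\<close> for the root polynomial of \<open>s\<close>, \<open>Q = P' / n\<close>, and \<open>Q\<^sup>*\<close> for the conjugate reciprocal
  of \<open>Q\<close>. Always \<open>P = x Q + (P - x Q)\<close>, where \<open>P - x Q\<close> has the coefficients of \<open>P\<close> weighted by
  \<open>i / n\<close> instead of \<open>(n - i) / n\<close>. The symmetry \<open>s\<^sub>i = s\<^sub>n cnj s\<^bsub>n-i\<^esub>\<close> exchanges the two
  weightings up to conjugation and reversal, so \<open>P - x Q = \<plusminus> s\<^sub>n Q\<^sup>*\<close>.
\<close>

lemma cohn_identity:
  assumes "n \<ge> 1" "x \<noteq> 0" "cmod (s n) = 1"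
    and reflect: "\<forall>i\<in>{1..n-1}. cnj (s n) * s i = cnj (s (n - i))"
  shows "root_poly n s x = x * root_poly (n - 1) (derived n s) x +
    (- 1) ^ n * s n * (x ^ (n - 1) * cnj (root_poly (n - 1) (derived n s) (1 / cnj x)))"
proof -
  define e where "e i = (if i = 0 then 1 else s i)" for i
  have sn: "s n * cnj (s n) = 1" using assms(3) complex_norm_square[of "s n"] by simp
  have e: "e i = s n * cnj (e (n - i))" if "i \<le> n" for i
  proof (cases "i = 0 \<or> i = n")
    case True
    then show ?thesis using assms(1) sn by (auto simp: e_def)
  next
    case False
    then have "cnj (s n) * s i = cnj (s (n - i))" using reflect that by auto
    then have "s n * cnj (s n) * s i = s n * cnj (s (n - i))" by (simp add: mult.assoc)
    then show ?thesis using False that sn by (simp add: e_def)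
  qed
  have d: "(if i = 0 then 1 else derived n s i) = of_nat (n - i) / of_nat n * e i" if "i \<le> n - 1" for i
    using assms(1) that by (simp add: e_def derived_def)
  have "of_nat n * root_poly n s x = (\<Sum>i\<le>n. (- 1) ^ i * of_nat (n - i) * e i * x ^ (n - i))
      + (\<Sum>i\<le>n. (- 1) ^ i * of_nat i * e i * x ^ (n - i))"
    unfolding root_poly_altdef sum_distrib_left sum.distrib[symmetric]
    by (intro sum.cong refl) (auto simp: e_def of_nat_diff algebra_simps)
  also have "(\<Sum>i\<le>n. (- 1) ^ i * of_nat (n - i) * e i * x ^ (n - i))
      = (\<Sum>i\<le>n-1. (- 1) ^ i * of_nat (n - i) * e i * x ^ (n - i))"
    by (rule sum.mono_neutral_right) auto
  also have "\<dots> = of_nat n * (x * root_poly (n - 1) (derived n s) x)"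
    unfolding root_poly_altdef sum_distrib_left
  proof (rule sum.cong[OF refl])
    fix i assume "i \<in> {..n-1}"
    then have i: "i \<le> n - 1" and "n - i = Suc (n - 1 - i)" using assms(1) by auto
    then have "x ^ (n - i) = x * x ^ (n - 1 - i)" by simp
    then show "(- 1) ^ i * of_nat (n - i) * e i * x ^ (n - i) = of_nat n *
        (x * ((- 1) ^ i * (if i = 0 then 1 else derived n s i) * x ^ (n - 1 - i)))"
      unfolding d[OF i] using assms(1) by simp
  qed
  also have "(\<Sum>i\<le>n. (- 1) ^ i * of_nat i * e i * x ^ (n - i))
      = (\<Sum>i\<le>n. (- 1) ^ (n - i) * of_nat (n - i) * e (n - i) * x ^ i)"
    by (rule sum.reindex_bij_witness[of _ "\<lambda>i. n - i" "\<lambda>i. n - i"]) auto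
  also have "\<dots> = (\<Sum>i\<le>n-1. (- 1) ^ (n - i) * of_nat (n - i) * e (n - i) * x ^ i)"
    by (rule sum.mono_neutral_right) auto
  also have "\<dots> = of_nat n * ((- 1) ^ n * s n *
      (\<Sum>i\<le>n-1. (- 1) ^ i * cnj (if i = 0 then 1 else derived n s i) * x ^ i))"
    unfolding sum_distrib_left
  proof (rule sum.cong[OF refl])
    fix i assume "i \<in> {..n-1}"
    then have i: "i \<le> n - 1" and "i \<le> n" by auto
    have "(- 1 :: complex) ^ (n - i) = (- 1) ^ n * (- 1) ^ i"
      using \<open>i \<le> n\<close> by (simp add: uminus_power_if)
    moreover have "e (n - i) = s n * cnj (e i)"
      using e[of "n - i"] \<open>i \<le> n\<close> by simp
    ultimately show "(- 1) ^ (n - i) * of_nat (n - i) * e (n - i) * x ^ i = of_nat n *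
        ((- 1) ^ n * s n * ((- 1) ^ i * cnj (if i = 0 then 1 else derived n s i) * x ^ i))"
      unfolding d[OF i] using assms(1) by simp
  qed
  also note root_poly_reciprocal[OF assms(2)]
  finally have "of_nat n * root_poly n s x = of_nat n * (x * root_poly (n - 1) (derived n s) x +
    (- 1) ^ n * s n * (x ^ (n - 1) * cnj (root_poly (n - 1) (derived n s) (1 / cnj x))))"
    by (simp only: distrib_left)
  then show ?thesis using assms(1) by simp
qed

lemma norm_reflected_le:
  assumes "cmod w \<le> 1" "cmod x \<ge> 1"
  shows "cmod (1 - cnj w * x) \<le> cmod (x - w)"
proof -
  have "(cmod (x - w))\<^sup>2 - (cmod (1 - cnj w * x))\<^sup>2 = ((cmod x)\<^sup>2 - 1) * (1 - (cmod w)\<^sup>2)"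
    unfolding cmod_power2 by (simp add: algebra_simps power2_eq_square)
  also have "\<dots> \<ge> 0"
    using assms by (intro mult_nonneg_nonneg) (auto simp: power_le_one)
  finally show ?thesis by (auto intro: power2_le_imp_le)
qed

text \<open>
  Each factor \<open>1 - cnj w x\<close> of the conjugate reciprocal polynomial is dominated outside the disc by
  the corresponding factor \<open>x - w\<close>.
\<close>

lemma norm_reciprocal_root_poly_le:
  assumes "restrict s {1..m} \<in> sym_disc m" "cmod x \<ge> 1"
  shows "cmod (x ^ m * cnj (root_poly m s (1 / cnj x))) \<le> cmod (root_poly m s x)"
proof -
  obtain w where w: "\<And>x. root_poly m s x = (\<Prod>j\<in>{1..m}. x - w j)"
    using root_poly_splits[of m s] by metis
  have "root_poly m s (w j) = 0" if "j \<in> {1..m}" for j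
    unfolding w using that by (intro prod_zero) auto
  then have w1: "cmod (w j) \<le> 1" if "j \<in> {1..m}" for j
    using assms(1) that unfolding sym_disc_iff by blast
  have "x \<noteq> 0" using assms(2) by auto
  have "x ^ m * cnj (root_poly m s (1 / cnj x)) = (\<Prod>j\<in>{1..m}. x * cnj (1 / cnj x - w j))"
    unfolding w by (simp add: prod.distrib)
  also have "\<dots> = (\<Prod>j\<in>{1..m}. 1 - cnj (w j) * x)"
    using \<open>x \<noteq> 0\<close> by (intro prod.cong) (auto simp: algebra_simps)
  also have "cmod \<dots> \<le> cmod (\<Prod>j\<in>{1..m}. x - w j)"
    unfolding prod_norm[symmetric] using w1 assms(2)
    by (intro prod_mono conjI norm_reflected_le) auto
  finally show ?thesis by (simp only: w)
qed

text \<open>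
  Cohn's theorem. At a root \<open>x\<close> of \<open>P\<close> with \<open>|x| > 1\<close> the identity above gives
  \<open>|x| |Q x| = |Q\<^sup>* x| \<le> |Q x|\<close>, whereas \<open>Q x \<noteq> 0\<close> because the roots of \<open>Q\<close> lie in the disc.
\<close>

lemma in_sym_disc_if_derived:
  assumes "n \<ge> 1" "cmod (s n) = 1" "\<forall>i\<in>{1..n-1}. cnj (s n) * s i = cnj (s (n - i))"
    and "derived n s \<in> sym_disc (n - 1)"
  shows "restrict s {1..n} \<in> sym_disc n"
  unfolding sym_disc_iff
proof (intro allI impI, rule ccontr)
  fix x assume x: "root_poly n s x = 0" "\<not> cmod x \<le> 1"
  define q where "q = root_poly (n - 1) (derived n s) x"
  have d: "restrict (derived n s) {1..n-1} \<in> sym_disc (n - 1)"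
    using assms(4) by (simp add: derived_def)
  then have "q \<noteq> 0" using x(2) unfolding sym_disc_iff q_def by blast
  have "x \<noteq> 0" using x(2) by auto
  define r where "r = x ^ (n - 1) * cnj (root_poly (n - 1) (derived n s) (1 / cnj x))"
  have "x * q = - ((- 1) ^ n * s n * r)"
    using cohn_identity[OF assms(1) \<open>x \<noteq> 0\<close> assms(2,3)] x(1)
    unfolding q_def r_def by (simp add: eq_neg_iff_add_eq_0)
  then have "cmod x * cmod q = cmod ((- 1) ^ n * s n * r)"
    by (metis norm_minus_cancel norm_mult)
  also have "\<dots> = cmod r" using assms(2) by (simp add: norm_mult norm_power)
  also have "\<dots> \<le> cmod q"
    unfolding q_def r_def using norm_reciprocal_root_poly_le[OF d] x(2) by simp
  finally show False using \<open>q \<noteq> 0\<close> x(2) by simp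
qed

lemma sym_torus_iff_derived:
  assumes "n \<ge> 1"
  shows "restrict s {1..n} \<in> sym_torus n \<longleftrightarrow>
    cmod (s n) = 1 \<and> (\<forall>i\<in>{1..n-1}. cnj (s n) * s i = cnj (s (n - i))) \<and>
    derived n s \<in> sym_disc (n - 1)"
proof
  assume T: "restrict s {1..n} \<in> sym_torus n"
  then obtain z where z: "z \<in> {1..n} \<rightarrow>\<^sub>E sphere 0 1" "restrict s {1..n} = symmetrization n z"
    by (auto simp: sym_torus_def)
  have "s i = elem_sym n i z" if "i \<in> {1..n}" for i
    using fun_cong[OF z(2), of i] that by (simp add: symmetrization_def)
  then have "\<forall>i\<in>{1..n-1}. cnj (s n) * s i = cnj (s (n - i))"
    using assms z(1) elem_sym_reflect[of z n] by (auto simp: PiE_def)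
  then show "cmod (s n) = 1 \<and> (\<forall>i\<in>{1..n-1}. cnj (s n) * s i = cnj (s (n - i))) \<and>
    derived n s \<in> sym_disc (n - 1)"
    using T derived_in_sym_disc[OF assms] unfolding sym_torus_iff_sym_disc[OF assms] by blast
next
  assume "cmod (s n) = 1 \<and> (\<forall>i\<in>{1..n-1}. cnj (s n) * s i = cnj (s (n - i))) \<and>
    derived n s \<in> sym_disc (n - 1)"
  then show "restrict s {1..n} \<in> sym_torus n"
    using in_sym_disc_if_derived[OF assms] unfolding sym_torus_iff_sym_disc[OF assms] by blast
qed

section \<open>Complex differentiability on \<open>\<complex>\<^sup>n\<close>\<close>

lemma topspace_Cn [simp]: "topspace (Cn_topology n) = extensional {1..n}"
  by (simp add: Cn_topology_def PiE_def)

lemma continuous_map_into_Cn: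
  "continuous_map X (Cn_topology n) g \<longleftrightarrow>
    g ` topspace X \<subseteq> extensional {1..n} \<and> (\<forall>i\<in>{1..n}. continuous_map X euclidean (\<lambda>x. g x i))"
  unfolding Cn_topology_def continuous_map_componentwise by auto

lemma continuous_map_euclidean_iff:
  "continuous_map X euclidean f \<longleftrightarrow> (\<forall>x\<in>topspace X. (f \<longlongrightarrow> f x) (atin X x))"
  by (simp add: continuous_map_atin)

abbreviation Cn_dist :: "nat \<Rightarrow> (nat \<Rightarrow> complex) \<Rightarrow> (nat \<Rightarrow> complex) \<Rightarrow> real" where
  "Cn_dist n w z \<equiv> L2_set (\<lambda>i. cmod (w i - z i)) {1..n}"

lemma coord_le_Cn_dist: "i \<in> {1..n} \<Longrightarrow> cmod (w i - z i) \<le> Cn_dist n w z"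
  by (rule member_le_L2_set) auto

lemma Cn_dist_eq_0:
  assumes "w \<in> extensional {1..n}" "z \<in> extensional {1..n}" "Cn_dist n w z = 0"
  shows "w = z"
proof (rule extensionalityI[OF assms(1,2)])
  show "w i = z i" if "i \<in> {1..n}" for i
    using coord_le_Cn_dist[OF that, of w z] assms(3) by simp
qed

text \<open>
  All test functions needed below are polynomials in the coordinates. This class contains the
  coordinates and is closed under the ring operations, and it lies in the algebra of the
  symmetrized disc.
\<close>

definition Cn_entire :: "nat \<Rightarrow> ((nat \<Rightarrow> complex) \<Rightarrow> complex) \<Rightarrow> bool" where
  "Cn_entire n f \<longleftrightarrow> continuous_map (Cn_topology n) euclidean f \<and>
     (\<forall>z\<in>topspace (Cn_topology n). complex_differentiable_at n f z)"

lemma Cn_entire_const: "Cn_entire n (\<lambda>_. a)"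
  unfolding Cn_entire_def complex_differentiable_at_def
  by (auto intro!: exI[of _ "\<lambda>_. 0"])

lemma Cn_entire_coord:
  assumes "i \<in> {1..n}"
  shows "Cn_entire n (\<lambda>w. w i)"
  unfolding Cn_entire_def complex_differentiable_at_def
proof (intro conjI ballI exI)
  show "continuous_map (Cn_topology n) euclidean (\<lambda>w. w i)"
    using continuous_map_product_coordinates[OF assms, of "\<lambda>_. euclidean"]
    unfolding Cn_topology_def .
  have "(\<Sum>j = 1..n. (if j = i then 1 else 0) * (w j - z j)) = w i - z i" for w z :: "nat \<Rightarrow> complex"
  proof -
    have "(\<Sum>j = 1..n. (if j = i then 1 else 0) * (w j - z j))
        = (\<Sum>j = 1..n. if i = j then w j - z j else 0)" by (intro sum.cong) auto
    then show ?thesis using assms by (simp add: sum.delta)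
  qed
  then show "((\<lambda>w. (w i - z i - (\<Sum>j = 1..n. (if j = i then 1 else 0) * (w j - z j))) /
      complex_of_real (Cn_dist n w z)) \<longlongrightarrow> 0) (atin (Cn_topology n) z)" for z
    by simp
qed

lemma Cn_entire_add:
  assumes "Cn_entire n f" "Cn_entire n g"
  shows "Cn_entire n (\<lambda>w. f w + g w)"
  unfolding Cn_entire_def
proof (intro conjI ballI)
  show "continuous_map (Cn_topology n) euclidean (\<lambda>w. f w + g w)"
    using assms by (auto simp: Cn_entire_def continuous_map_euclidean_iff intro!: tendsto_add)
  fix z assume z: "z \<in> topspace (Cn_topology n)"
  let ?F = "atin (Cn_topology n) z"
  obtain c where c: "((\<lambda>w. (f w - f z - (\<Sum>i=1..n. c i * (w i - z i))) /
      of_real (Cn_dist n w z)) \<longlongrightarrow> 0) ?F"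
    using assms(1) z by (auto simp: Cn_entire_def complex_differentiable_at_def)
  obtain d where d: "((\<lambda>w. (g w - g z - (\<Sum>i=1..n. d i * (w i - z i))) /
      of_real (Cn_dist n w z)) \<longlongrightarrow> 0) ?F"
    using assms(2) z by (auto simp: Cn_entire_def complex_differentiable_at_def)
  have "(f w - f z - (\<Sum>i=1..n. c i * (w i - z i))) + (g w - g z - (\<Sum>i=1..n. d i * (w i - z i)))
      = f w + g w - (f z + g z) - (\<Sum>i=1..n. (c i + d i) * (w i - z i))" for w
    by (simp add: distrib_right sum.distrib)
  then have "((\<lambda>w. (f w + g w - (f z + g z) - (\<Sum>i=1..n. (c i + d i) * (w i - z i))) /
      of_real (Cn_dist n w z)) \<longlongrightarrow> 0) ?F"
    using tendsto_add[OF c d] by (simp only: add_divide_distrib[symmetric] add_0_right)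
  then show "complex_differentiable_at n (\<lambda>w. f w + g w) z"
    unfolding complex_differentiable_at_def by (intro exI[of _ "\<lambda>i. c i + d i"])
qed

lemma norm_linear_form_le:
  "cmod (\<Sum>i=1..n. d i * (w i - z i)) \<le> (\<Sum>i=1..n. cmod (d i)) * Cn_dist n w z"
proof -
  have "cmod (\<Sum>i=1..n. d i * (w i - z i)) \<le> (\<Sum>i=1..n. cmod (d i) * Cn_dist n w z)"
    by (intro sum_norm_le) (simp only: norm_mult coord_le_Cn_dist mult_left_mono norm_ge_zero)
  then show ?thesis by (simp add: sum_distrib_right)
qed

text \<open>
  The product rule: the remainder of \<open>f g\<close> is \<open>f w\<close> times the remainder of \<open>g\<close>, plus \<open>g z\<close> times that
  of \<open>f\<close>, plus \<open>f w - f z\<close> times the linear part of \<open>g\<close>; the last term is small because \<open>f\<close> is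
  continuous and a linear form is bounded by the distance.
\<close>

lemma Cn_entire_mult:
  assumes "Cn_entire n f" "Cn_entire n g"
  shows "Cn_entire n (\<lambda>w. f w * g w)"
  unfolding Cn_entire_def
proof (intro conjI ballI)
  show "continuous_map (Cn_topology n) euclidean (\<lambda>w. f w * g w)"
    using assms by (auto simp: Cn_entire_def continuous_map_euclidean_iff intro!: tendsto_mult)
  fix z assume z: "z \<in> topspace (Cn_topology n)"
  let ?F = "atin (Cn_topology n) z" and ?r = "\<lambda>w. complex_of_real (Cn_dist n w z)"
  have f: "(f \<longlongrightarrow> f z) ?F"
    using assms(1) z unfolding Cn_entire_def continuous_map_euclidean_iff by blast
  obtain c where c: "((\<lambda>w. (f w - f z - (\<Sum>i=1..n. c i * (w i - z i))) / ?r w) \<longlongrightarrow> 0) ?F"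
    using assms(1) z by (auto simp: Cn_entire_def complex_differentiable_at_def)
  obtain d where d: "((\<lambda>w. (g w - g z - (\<Sum>i=1..n. d i * (w i - z i))) / ?r w) \<longlongrightarrow> 0) ?F"
    using assms(2) z by (auto simp: Cn_entire_def complex_differentiable_at_def)
  have df: "((\<lambda>w. (f w - f z) * ((\<Sum>i=1..n. d i * (w i - z i)) / ?r w)) \<longlongrightarrow> 0) ?F"
  proof (rule Lim_null_comparison)
    have "cmod ((\<Sum>i=1..n. d i * (w i - z i)) / ?r w) \<le> (\<Sum>i=1..n. cmod (d i))" for w
    proof (cases "Cn_dist n w z = 0")
      case False
      then have "Cn_dist n w z > 0" using L2_set_nonneg[of "\<lambda>i. cmod (w i - z i)" "{1..n}"] by linarith
      then show ?thesis
        using norm_linear_form_le[where d=d and w=w and z=z and n=n]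
        by (simp add: norm_divide pos_divide_le_eq)
    qed (simp add: sum_nonneg)
    then show "\<forall>\<^sub>F w in ?F. norm ((f w - f z) * ((\<Sum>i=1..n. d i * (w i - z i)) / ?r w))
        \<le> cmod (f w - f z) * (\<Sum>i=1..n. cmod (d i))"
      unfolding norm_mult by (intro always_eventually allI mult_left_mono) auto
    have "((\<lambda>w. cmod (f w - f z)) \<longlongrightarrow> 0) ?F"
      using f by (intro tendsto_norm_zero) (simp add: LIM_zero)
    then show "((\<lambda>w. cmod (f w - f z) * (\<Sum>i=1..n. cmod (d i))) \<longlongrightarrow> 0) ?F"
      by (rule tendsto_mult_left_zero)
  qed
  have "((\<lambda>w. f w * ((g w - g z - (\<Sum>i=1..n. d i * (w i - z i))) / ?r w)
      + g z * ((f w - f z - (\<Sum>i=1..n. c i * (w i - z i))) / ?r w)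
      + (f w - f z) * ((\<Sum>i=1..n. d i * (w i - z i)) / ?r w)) \<longlongrightarrow> f z * 0 + g z * 0 + 0) ?F"
    by (intro tendsto_add tendsto_mult f c d df tendsto_const)
  moreover have "f w * ((g w - g z - (\<Sum>i=1..n. d i * (w i - z i))) / ?r w)
      + g z * ((f w - f z - (\<Sum>i=1..n. c i * (w i - z i))) / ?r w)
      + (f w - f z) * ((\<Sum>i=1..n. d i * (w i - z i)) / ?r w)
    = (f w * g w - f z * g z - (\<Sum>i=1..n. (f z * d i + g z * c i) * (w i - z i))) / ?r w" for w
  proof -
    have "(\<Sum>i=1..n. (f z * d i + g z * c i) * (w i - z i))
        = f z * (\<Sum>i=1..n. d i * (w i - z i)) + g z * (\<Sum>i=1..n. c i * (w i - z i))"
      by (simp add: sum_distrib_left sum.distrib[symmetric] algebra_simps)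
    then show ?thesis by (simp add: add_divide_distrib[symmetric] algebra_simps)
  qed
  ultimately have "((\<lambda>w. (f w * g w - f z * g z - (\<Sum>i=1..n. (f z * d i + g z * c i) * (w i - z i)))
      / ?r w) \<longlongrightarrow> 0) ?F"
    by simp
  then show "complex_differentiable_at n (\<lambda>w. f w * g w) z"
    unfolding complex_differentiable_at_def by (intro exI[of _ "\<lambda>i. f z * d i + g z * c i"])
qed

lemma Cn_entire_sum:
  "(\<And>k. k \<in> I \<Longrightarrow> Cn_entire n (f k)) \<Longrightarrow> Cn_entire n (\<lambda>w. \<Sum>k\<in>I. f k w)"
  by (induction I rule: infinite_finite_induct) (auto intro: Cn_entire_const Cn_entire_add)

lemma Cn_entire_prod:
  "(\<And>k. k \<in> I \<Longrightarrow> Cn_entire n (f k)) \<Longrightarrow> Cn_entire n (\<lambda>w. \<Prod>k\<in>I. f k w)"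
  by (induction I rule: infinite_finite_induct) (auto intro: Cn_entire_const Cn_entire_mult)

lemma Cn_entire_power: "Cn_entire n f \<Longrightarrow> Cn_entire n (\<lambda>w. f w ^ M)"
  by (induction M) (auto intro: Cn_entire_const Cn_entire_mult)

lemma Cn_entire_root_poly: "Cn_entire n (\<lambda>w. root_poly n w a)"
  unfolding root_poly_def
  by (intro Cn_entire_add Cn_entire_sum Cn_entire_mult Cn_entire_const Cn_entire_coord)

lemma Cn_entire_in_algebra:
  assumes "Cn_entire n f"
  shows "f \<in> sym_disc_algebra n"
proof -
  have "Cn_topology n interior_of sym_disc n \<subseteq> topspace (Cn_topology n)"
    by (rule interior_of_subset_topspace)
  then show ?thesis
    using assms unfolding Cn_entire_def sym_disc_algebra_def analytic_on_Cn_def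
    by (auto intro: continuous_map_from_subtopology)
qed

lemma continuous_map_symmetrization:
  "continuous_map (Cn_topology n) (Cn_topology n) (symmetrization n)"
proof -
  have "Cn_entire n (elem_sym n i)" for i
    unfolding elem_sym_def by (intro Cn_entire_sum Cn_entire_prod Cn_entire_coord) auto
  then have "continuous_map (Cn_topology n) euclidean (elem_sym n i)" for i
    by (simp add: Cn_entire_def)
  then show ?thesis
    unfolding continuous_map_into_Cn by (auto simp: symmetrization_def)
qed

text \<open>
  The chain rule along a holomorphic curve, which brings questions about functions on
  \<open>\<complex>\<^sup>n\<close> back to functions of one complex variable.
\<close>

lemma field_differentiable_along_curve:
  assumes f: "complex_differentiable_at n f (g a)"
    and S: "open S" "a \<in> S"
    and ext: "\<And>x. x \<in> S \<Longrightarrow> g x \<in> extensional {1..n}"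
    and hol: "\<And>i. i \<in> {1..n} \<Longrightarrow> (\<lambda>x. g x i) holomorphic_on S"
  shows "(\<lambda>x. f (g x)) field_differentiable at a"
proof -
  define z where "z = g a"
  obtain c where c: "((\<lambda>w. (f w - f z - (\<Sum>i=1..n. c i * (w i - z i))) /
      of_real (Cn_dist n w z)) \<longlongrightarrow> 0) (atin (Cn_topology n) z)"
    using f by (auto simp: complex_differentiable_at_def z_def)
  define R where "R w = (f w - f z - (\<Sum>i=1..n. c i * (w i - z i))) / of_real (Cn_dist n w z)" for w
  have zext: "z \<in> extensional {1..n}" using ext S by (simp add: z_def)
  have cont: "continuous_map (top_of_set S) (Cn_topology n) g"
    unfolding continuous_map_into_Cn using ext hol holomorphic_on_imp_continuous_on by auto
  have R0: "((\<lambda>x. R (g x)) \<longlongrightarrow> 0) (at a)"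
  proof (rule tendstoI)
    fix e :: real assume "e > 0"
    then have "\<forall>\<^sub>F w in atin (Cn_topology n) z. dist (R w) 0 < e"
      using c unfolding R_def by (rule tendstoD[rotated])
    then obtain U where U: "openin (Cn_topology n) U" "z \<in> U" "\<And>w. w \<in> U - {z} \<Longrightarrow> dist (R w) 0 < e"
      unfolding eventually_atin using zext by auto
    \<comment> \<open>At \<open>z\<close> the quotient is \<open>0 / 0 = 0\<close>, so the bound holds on all of \<open>U\<close>. The curve may
      return to \<open>z\<close> at other parameters than \<open>a\<close>.\<close>
    have "R z = 0" by (simp add: R_def)
    then have Ue: "dist (R w) 0 < e" if "w \<in> U" for w
      using U(3)[of w] that \<open>e > 0\<close> by (cases "w = z") auto
    have "openin (top_of_set S) {x \<in> S. g x \<in> U}"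
      using openin_continuous_map_preimage[OF cont U(1)] by simp
    then have "open {x \<in> S. g x \<in> U}" using S(1) openin_open_eq by blast
    moreover have "a \<in> {x \<in> S. g x \<in> U}" using S U by (simp add: z_def)
    ultimately show "\<forall>\<^sub>F x in at a. dist (R (g x)) 0 < e"
      unfolding eventually_at_topological using Ue by blast
  qed
  define D where "D i = deriv (\<lambda>x. g x i) a" for i
  have D: "((\<lambda>x. (g x i - z i) / (x - a)) \<longlongrightarrow> D i) (at a)" if "i \<in> {1..n}" for i
    using holomorphic_derivI[OF hol[OF that] S] unfolding D_def has_field_derivative_iff z_def .
  have dR: "((\<lambda>x. R (g x) * (of_real (Cn_dist n (g x) z) / (x - a))) \<longlongrightarrow> 0) (at a)"
  proof (rule Lim_null_comparison)
    have "cmod (of_real (Cn_dist n (g x) z) / (x - a)) \<le> (\<Sum>i=1..n. cmod ((g x i - z i) / (x - a)))" for x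
    proof -
      have "Cn_dist n (g x) z \<le> (\<Sum>i=1..n. cmod (g x i - z i))" by (rule L2_set_le_sum) auto
      then show ?thesis
        by (simp add: norm_divide L2_set_nonneg sum_divide_distrib[symmetric] divide_right_mono)
    qed
    then show "\<forall>\<^sub>F x in at a. norm (R (g x) * (of_real (Cn_dist n (g x) z) / (x - a)))
        \<le> cmod (R (g x)) * (\<Sum>i=1..n. cmod ((g x i - z i) / (x - a)))"
      unfolding norm_mult by (intro always_eventually allI mult_left_mono) auto
    have "((\<lambda>x. cmod (R (g x)) * (\<Sum>i=1..n. cmod ((g x i - z i) / (x - a))))
        \<longlongrightarrow> 0 * (\<Sum>i=1..n. cmod (D i))) (at a)"
      by (intro tendsto_mult tendsto_sum tendsto_norm D tendsto_norm_zero R0)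
    then show "((\<lambda>x. cmod (R (g x)) * (\<Sum>i=1..n. cmod ((g x i - z i) / (x - a)))) \<longlongrightarrow> 0) (at a)"
      by simp
  qed
  have split: "(f (g x) - f z) / (x - a) = (\<Sum>i=1..n. c i * ((g x i - z i) / (x - a)))
      + R (g x) * (of_real (Cn_dist n (g x) z) / (x - a))" if "x \<in> S" for x
  proof -
    have "R (g x) * of_real (Cn_dist n (g x) z) = f (g x) - f z - (\<Sum>i=1..n. c i * (g x i - z i))"
      using Cn_dist_eq_0[OF ext[OF that] zext] by (auto simp: R_def)
    then have "f (g x) - f z = (\<Sum>i=1..n. c i * (g x i - z i)) + R (g x) * of_real (Cn_dist n (g x) z)"
      by simp
    then show ?thesis by (simp add: add_divide_distrib sum_divide_distrib)
  qed
  have "((\<lambda>x. (\<Sum>i=1..n. c i * ((g x i - z i) / (x - a)))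
      + R (g x) * (of_real (Cn_dist n (g x) z) / (x - a))) \<longlongrightarrow> (\<Sum>i=1..n. c i * D i) + 0) (at a)"
    by (intro tendsto_add tendsto_sum tendsto_mult tendsto_const D dR)
  moreover have "\<forall>\<^sub>F x in at a. (\<Sum>i=1..n. c i * ((g x i - z i) / (x - a)))
      + R (g x) * (of_real (Cn_dist n (g x) z) / (x - a)) = (f (g x) - f (g a)) / (x - a)"
    unfolding eventually_at_topological using S split by (auto simp: z_def)
  ultimately have "((\<lambda>x. (f (g x) - f (g a)) / (x - a)) \<longlongrightarrow> (\<Sum>i=1..n. c i * D i) + 0) (at a)"
    by (rule Lim_transform_eventually)
  then show ?thesis
    unfolding field_differentiable_def has_field_derivative_iff by blast
qed

section \<open>The maximum principle on the symmetrized disc\<close>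

lemma symmetrization_extensional: "symmetrization n z \<in> extensional {1..n}"
  by (simp add: symmetrization_def)

text \<open>
  Roots in the open disc stay in the disc under small changes of the coefficients: for \<open>|x| > 1\<close> the
  polynomial with roots \<open>z\<^sub>j\<close> has modulus at least \<open>|x|\<^sup>n \<Prod>(1 - |z\<^sub>j|)\<close>, while a change of each
  coefficient by \<open>\<epsilon>\<close> changes its value by at most \<open>n \<epsilon> |x|\<^sup>n\<close>.
\<close>

lemma symmetrization_in_interior:
  assumes z: "z \<in> {1..n} \<rightarrow>\<^sub>E ball 0 1"
  shows "symmetrization n z \<in> Cn_topology n interior_of sym_disc n"
proof -
  define s where "s = symmetrization n z"
  define \<delta> where "\<delta> = (\<Prod>j\<in>{1..n}. 1 - cmod (z j))"
  \<comment> \<open>The denominator makes \<open>n \<epsilon> < \<delta>\<close>, also for \<open>n = 0\<close>.\<close>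
  define \<epsilon> where "\<epsilon> = \<delta> / (real n + 1)"
  have "\<delta> > 0" unfolding \<delta>_def using z by (intro prod_pos) (auto simp: PiE_iff)
  then have "\<epsilon> > 0" by (simp add: \<epsilon>_def)
  define U where "U = (\<Pi>\<^sub>E i\<in>{1..n}. ball (s i) \<epsilon>)"
  have "openin (Cn_topology n) U"
    unfolding U_def Cn_topology_def by (subst openin_PiE_gen) auto
  moreover have "s \<in> U"
    using \<open>\<epsilon> > 0\<close> by (auto simp: U_def s_def symmetrization_def)
  moreover have "U \<subseteq> sym_disc n"
  proof
    fix w assume w: "w \<in> U"
    have close: "cmod (s i - w i) \<le> \<epsilon>" if "i \<in> {1..n}" for i
    proof -
      have "w i \<in> ball (s i) \<epsilon>" using w that unfolding U_def by blast
      then show ?thesis by (simp add: dist_norm)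
    qed
    have "cmod x \<le> 1" if root: "root_poly n w x = 0" for x
    proof (rule ccontr)
      assume "\<not> cmod x \<le> 1"
      then have x: "cmod x > 1" by simp
      have "cmod x ^ n * \<delta> = (\<Prod>j\<in>{1..n}. cmod x * (1 - cmod (z j)))"
        by (simp add: \<delta>_def prod.distrib)
      also have "\<dots> \<le> (\<Prod>j\<in>{1..n}. cmod (x - z j))"
      proof (intro prod_mono conjI)
        fix j assume j: "j \<in> {1..n}"
        then have zj: "cmod (z j) \<le> 1" using z by (auto simp: PiE_iff less_imp_le)
        then show "0 \<le> cmod x * (1 - cmod (z j))" by simp
        have "cmod x * (1 - cmod (z j)) = cmod x - cmod x * cmod (z j)"
          by (simp add: right_diff_distrib)
        also have "\<dots> \<le> cmod x - cmod (z j)"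
          using x mult_right_mono[of 1 "cmod x" "cmod (z j)"] by simp
        also have "\<dots> \<le> cmod (x - z j)" by (rule norm_triangle_ineq2)
        finally show "cmod x * (1 - cmod (z j)) \<le> cmod (x - z j)" .
      qed
      also have "\<dots> = cmod (root_poly n s x - root_poly n w x)"
        unfolding root s_def root_poly_symmetrization by (simp add: prod_norm)
      also have "root_poly n s x - root_poly n w x
          = (\<Sum>i=1..n. (- 1) ^ i * (s i - w i) * x ^ (n - i))"
        by (simp add: root_poly_def sum_subtractf[symmetric] algebra_simps)
      also have "cmod \<dots> \<le> (\<Sum>i=1..n. \<epsilon> * cmod x ^ n)"
      proof (rule sum_norm_le)
        fix i assume i: "i \<in> {1..n}"
        have "cmod x ^ (n - i) \<le> cmod x ^ n" using x by (intro power_increasing) auto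
        then show "cmod ((- 1) ^ i * (s i - w i) * x ^ (n - i)) \<le> \<epsilon> * cmod x ^ n"
          using close[OF i] \<open>\<epsilon> > 0\<close> by (simp add: norm_mult norm_power mult_mono)
      qed
      also have "\<dots> = cmod x ^ n * (real n * \<epsilon>)" by simp
      finally have "\<delta> \<le> real n * \<epsilon>"
        using mult_left_le_imp_le zero_less_power x by (metis less_trans zero_less_one)
      then show False using \<open>\<delta> > 0\<close> by (simp add: \<epsilon>_def field_simps)
    qed
    then have "restrict w {1..n} \<in> sym_disc n" unfolding sym_disc_iff by blast
    moreover have "restrict w {1..n} = w" using w by (auto simp: U_def PiE_iff extensional_restrict)
    ultimately show "w \<in> sym_disc n" by simp
  qed
  ultimately show ?thesis unfolding s_def[symmetric] interior_of_def by blast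
qed

lemma compactin_symmetrization_image:
  assumes "compact A"
  shows "compactin (Cn_topology n) (symmetrization n ` ({1..n} \<rightarrow>\<^sub>E A))"
  using assms unfolding Cn_topology_def
  by (intro image_compactin[OF _ continuous_map_symmetrization, unfolded Cn_topology_def])
     (simp add: compactin_PiE)

abbreviation sym_disc_space :: "nat \<Rightarrow> (nat \<Rightarrow> complex) topology" where
  "sym_disc_space n \<equiv> subtopology (Cn_topology n) (sym_disc n)"

lemma sym_disc_extensional: "sym_disc n \<subseteq> extensional {1..n}"
  by (auto simp: sym_disc_def symmetrization_def)

lemma topspace_sym_disc_space [simp]: "topspace (sym_disc_space n) = sym_disc n"
  using sym_disc_extensional by auto

lemma compact_sym_disc_space: "compact_space (sym_disc_space n)"
  using compactin_symmetrization_image[of "cball 0 1" n]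
  by (auto simp: sym_disc_def compact_space_subtopology)

lemma sym_torus_subset: "sym_torus n \<subseteq> sym_disc n"
  unfolding sym_torus_def sym_disc_def by (intro image_mono PiE_mono) auto

lemma closedin_sym_torus: "closedin (sym_disc_space n) (sym_torus n)"
proof (rule closedin_subset_topspace[OF _ sym_torus_subset])
  have "Hausdorff_space (Cn_topology n)"
    by (simp add: Cn_topology_def Hausdorff_space_product_topology)
  then show "closedin (Cn_topology n) (sym_torus n)"
    unfolding sym_torus_def
    by (rule compactin_imp_closedin[OF _ compactin_symmetrization_image]) simp
qed

lemma norm_attains_max_on_compactin:
  assumes "compactin X S" "S \<noteq> {}" "continuous_map X euclidean f"
  shows "\<exists>m\<in>S. \<forall>x\<in>S. norm (f x) \<le> norm (f m)"
proof -
  have "compactin euclidean (f ` S)" using assms(1,3) by (rule image_compactin)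
  then have "compact (f ` S)" by simp
  moreover have "f ` S \<noteq> {}" using assms(2) by simp
  ultimately have "\<exists>y\<in>f ` S. \<forall>x\<in>f ` S. norm x \<le> norm y"
    using continuous_attains_sup continuous_on_norm_id by blast
  then show ?thesis by blast
qed

lemma blaschke_factor:
  assumes "cmod a < 1" "cmod x \<le> 1"
  shows "1 + cnj a * x \<noteq> 0"
    and "cmod ((x + a) / (1 + cnj a * x)) \<le> 1"
    and "cmod x = 1 \<Longrightarrow> cmod ((x + a) / (1 + cnj a * x)) = 1"
    and "cmod x < 1 \<Longrightarrow> cmod ((x + a) / (1 + cnj a * x)) < 1"
proof -
  have "cmod (cnj a * x) < 1"
    using assms mult_le_one[of "cmod a" "cmod x"] mult_left_mono[of "cmod x" 1 "cmod a"]
    by (simp add: norm_mult)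
  then show ne: "1 + cnj a * x \<noteq> 0"
    by (metis add_eq_0_iff norm_minus_cancel norm_one order_less_irrefl)
  have "(cmod (1 + cnj a * x))\<^sup>2 - (cmod (x + a))\<^sup>2 = (1 - (cmod x)\<^sup>2) * (1 - (cmod a)\<^sup>2)"
    unfolding cmod_power2 by (simp add: algebra_simps power2_eq_square)
  moreover have "1 - (cmod a)\<^sup>2 > 0" using assms(1) by (simp add: power_less_one_iff)
  moreover have "1 - (cmod x)\<^sup>2 \<ge> 0" using assms(2) by (simp add: power_le_one)
  moreover have "cmod x < 1 \<Longrightarrow> 1 - (cmod x)\<^sup>2 > 0" by (simp add: power_less_one_iff)
  ultimately have "(cmod (x + a))\<^sup>2 \<le> (cmod (1 + cnj a * x))\<^sup>2"
    "cmod x = 1 \<Longrightarrow> (cmod (x + a))\<^sup>2 = (cmod (1 + cnj a * x))\<^sup>2"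
    "cmod x < 1 \<Longrightarrow> (cmod (x + a))\<^sup>2 < (cmod (1 + cnj a * x))\<^sup>2"
    by (smt (verit) mult_nonneg_nonneg mult_pos_pos mult_eq_0_iff power_one)+
  then have "cmod (x + a) \<le> cmod (1 + cnj a * x)"
    "cmod x = 1 \<Longrightarrow> cmod (x + a) = cmod (1 + cnj a * x)"
    "cmod x < 1 \<Longrightarrow> cmod (x + a) < cmod (1 + cnj a * x)"
    by (auto intro: power2_le_imp_le power2_eq_imp_eq power_less_imp_less_base)
  then show "cmod ((x + a) / (1 + cnj a * x)) \<le> 1"
    "cmod x = 1 \<Longrightarrow> cmod ((x + a) / (1 + cnj a * x)) = 1"
    "cmod x < 1 \<Longrightarrow> cmod ((x + a) / (1 + cnj a * x)) < 1"
    using ne by (simp_all add: norm_divide)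
qed

text \<open>
  The parameter \<open>S\<close> is the closed disc for an analytic disc in the polydisc and the unit interval
  for a radius.
\<close>

lemma algebra_continuous_along_curve:
  assumes f: "f \<in> sym_disc_algebra n"
    and ext: "\<And>x. x \<in> S \<Longrightarrow> \<phi> x \<in> {1..n} \<rightarrow>\<^sub>E cball 0 1"
    and cont: "\<And>j. j \<in> {1..n} \<Longrightarrow> continuous_on S (\<lambda>x. \<phi> x j)"
  shows "continuous_on S (\<lambda>x. f (symmetrization n (\<phi> x)))"
proof -
  have "continuous_map (top_of_set S) (Cn_topology n) \<phi>"
    unfolding continuous_map_into_Cn using ext cont by (auto simp: PiE_iff)
  then have "continuous_map (top_of_set S) (Cn_topology n) (symmetrization n \<circ> \<phi>)"
    using continuous_map_symmetrization by (rule continuous_map_compose)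
  then have "continuous_map (top_of_set S) (sym_disc_space n) (symmetrization n \<circ> \<phi>)"
    by (rule continuous_map_into_subtopology) (use ext in \<open>auto simp: sym_disc_def\<close>)
  moreover have "continuous_map (sym_disc_space n) euclidean f"
    using f by (simp add: sym_disc_algebra_def)
  ultimately have "continuous_map (top_of_set S) euclidean (f \<circ> (symmetrization n \<circ> \<phi>))"
    by (rule continuous_map_compose)
  then show ?thesis by (simp add: o_def)
qed

text \<open>
  Through \<open>z\<close> runs the analytic disc \<open>x \<mapsto> ((x + z\<^sub>j) / (1 + cnj z\<^sub>j x))\<^sub>j\<close>. It has \<open>z\<close> at its centre, stays
  in the open polydisc, where analyticity is available, and sends the unit circle into the torus.
  The maximum principle in one variable along it gives the bound.
\<close>

lemma maximum_modulus_open_polydisc: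
  assumes f: "f \<in> sym_disc_algebra n"
    and B: "\<And>k. k \<in> sym_torus n \<Longrightarrow> cmod (f k) \<le> B"
    and z: "z \<in> {1..n} \<rightarrow>\<^sub>E ball 0 1"
  shows "cmod (f (symmetrization n z)) \<le> B"
proof -
  define \<phi> where "\<phi> x = (\<lambda>j\<in>{1..n}. (x + z j) / (1 + cnj (z j) * x))" for x
  have z1: "cmod (z j) < 1" if "j \<in> {1..n}" for j using z that by (auto simp: PiE_iff)
  note ne = blaschke_factor(1)[OF z1]
  have \<phi>_disc: "\<phi> x \<in> {1..n} \<rightarrow>\<^sub>E cball 0 1" if "cmod x \<le> 1" for x
    using blaschke_factor(2)[OF z1 that] by (auto simp: \<phi>_def)
  have \<phi>_torus: "\<phi> x \<in> {1..n} \<rightarrow>\<^sub>E sphere 0 1" if "cmod x = 1" for x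
    using blaschke_factor(3)[OF z1 _ that] that by (auto simp: \<phi>_def)
  have \<phi>_ball: "\<phi> x \<in> {1..n} \<rightarrow>\<^sub>E ball 0 1" if "cmod x < 1" for x
    using blaschke_factor(4)[OF z1 _ that] that by (auto simp: \<phi>_def)
  have hol: "(\<lambda>x. symmetrization n (\<phi> x) i) holomorphic_on ball 0 1" if "i \<in> {1..n}" for i
  proof -
    have "(\<lambda>x. \<Sum>K | K \<subseteq> {1..n} \<and> card K = i. \<Prod>k\<in>K. (x + z k) / (1 + cnj (z k) * x))
        holomorphic_on ball 0 1"
      by (intro holomorphic_on_sum holomorphic_on_prod holomorphic_intros) (use ne in auto)
    moreover have "(\<Sum>K | K \<subseteq> {1..n} \<and> card K = i. \<Prod>k\<in>K. (x + z k) / (1 + cnj (z k) * x))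
        = symmetrization n (\<phi> x) i" for x
      using that unfolding symmetrization_def elem_sym_def \<phi>_def
      by (auto intro!: sum.cong prod.cong)
    ultimately show ?thesis by simp
  qed
  have "(\<lambda>x. f (symmetrization n (\<phi> x))) holomorphic_on ball 0 1"
  proof (rule holomorphic_onI)
    fix a :: complex assume a: "a \<in> ball 0 1"
    have "symmetrization n (\<phi> a) \<in> Cn_topology n interior_of sym_disc n"
      using a by (intro symmetrization_in_interior \<phi>_ball) simp
    then have "complex_differentiable_at n f (symmetrization n (\<phi> a))"
      using f by (simp add: sym_disc_algebra_def analytic_on_Cn_def)
    then have "(\<lambda>x. f (symmetrization n (\<phi> x))) field_differentiable at a"
      by (rule field_differentiable_along_curve[OF _ open_ball a symmetrization_extensional hol])
    then show "(\<lambda>x. f (symmetrization n (\<phi> x))) field_differentiable at a within ball 0 1"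
      by (rule field_differentiable_at_within)
  qed
  moreover have "continuous_on (cball 0 1) (\<lambda>x. f (symmetrization n (\<phi> x)))"
  proof (rule algebra_continuous_along_curve[OF f])
    show "continuous_on (cball 0 1) (\<lambda>x. \<phi> x j)" if "j \<in> {1..n}" for j
      using that ne by (auto simp: \<phi>_def intro!: continuous_intros)
  qed (use \<phi>_disc in auto)
  moreover have "cmod (f (symmetrization n (\<phi> x))) \<le> B" if "x \<in> sphere 0 1" for x
    using that \<phi>_torus by (intro B) (auto simp: sym_torus_def)
  ultimately have "cmod (f (symmetrization n (\<phi> 0))) \<le> B"
    using maximum_modulus_frontier[where f = "\<lambda>x. f (symmetrization n (\<phi> x))"
        and S = "ball 0 1" and B = B and \<xi> = 0] by simp
  moreover have "\<phi> 0 = z"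
    using z by (auto simp: \<phi>_def fun_eq_iff PiE_iff extensional_def)
  ultimately show ?thesis by simp
qed

text \<open>
  Points of the closed polydisc are reached along a radius from the open one; the bound by the
  maximum over the compact torus persists in the limit.
\<close>

lemma maximum_modulus_on_torus:
  assumes f: "f \<in> sym_disc_algebra n" and x: "x \<in> sym_disc n"
  shows "\<exists>k\<in>sym_torus n. cmod (f x) \<le> cmod (f k)"
proof -
  have "compactin (sym_disc_space n) (sym_torus n)"
    by (rule closedin_compact_space[OF compact_sym_disc_space closedin_sym_torus])
  moreover have "(\<lambda>j\<in>{1..n}. 1) \<in> {1..n} \<rightarrow>\<^sub>E sphere (0 :: complex) 1" by auto
  then have "sym_torus n \<noteq> {}" unfolding sym_torus_def by blast
  moreover have "continuous_map (sym_disc_space n) euclidean f"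
    using f by (simp add: sym_disc_algebra_def)
  ultimately obtain k
    where k: "k \<in> sym_torus n" "\<And>l. l \<in> sym_torus n \<Longrightarrow> cmod (f l) \<le> cmod (f k)"
    using norm_attains_max_on_compactin by blast
  obtain z where z: "z \<in> {1..n} \<rightarrow>\<^sub>E cball 0 1" "x = symmetrization n z"
    using x by (auto simp: sym_disc_def)
  define \<phi> where "\<phi> r = (\<lambda>j\<in>{1..n}. complex_of_real r * z j)" for r
  have z1: "cmod (z j) \<le> 1" if "j \<in> {1..n}" for j using z(1) that by (auto simp: PiE_iff)
  have "continuous_on {0..1} (\<lambda>r. f (symmetrization n (\<phi> r)))"
  proof (rule algebra_continuous_along_curve[OF f])
    show "\<phi> r \<in> {1..n} \<rightarrow>\<^sub>E cball 0 1" if "r \<in> {0..1}" for r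
      using that z1 by (auto simp: \<phi>_def norm_mult mult_le_one)
    show "continuous_on {0..1} (\<lambda>r. \<phi> r j)" if "j \<in> {1..n}" for j
      using that by (auto simp: \<phi>_def intro!: continuous_intros)
  qed
  then have "continuous_on (closure {0..<1}) (\<lambda>r. cmod (f (symmetrization n (\<phi> r))))"
    by (auto intro: continuous_on_norm)
  moreover have "cmod (f (symmetrization n (\<phi> r))) \<le> cmod (f k)" if r: "r \<in> {0..<1}" for r
  proof (rule maximum_modulus_open_polydisc[OF f k(2)])
    have "r * cmod (z j) < 1" if "j \<in> {1..n}" for j
      using r z1[OF that] mult_left_mono[of "cmod (z j)" 1 r] by auto
    then show "\<phi> r \<in> {1..n} \<rightarrow>\<^sub>E ball 0 1"
      using r by (auto simp: \<phi>_def norm_mult)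
  qed
  ultimately have "cmod (f (symmetrization n (\<phi> 1))) \<le> cmod (f k)"
    using continuous_le_on_closure[where S = "{0..<1::real}" and x = 1 and a = "cmod (f k)"
        and f = "\<lambda>r. cmod (f (symmetrization n (\<phi> r)))"] by simp
  moreover have "\<phi> 1 = z"
    using z by (auto simp: \<phi>_def fun_eq_iff PiE_iff extensional_def)
  ultimately show ?thesis using k(1) z(2) by blast
qed

lemma closed_boundary_sym_torus:
  "closed_boundary (sym_disc_space n) (sym_disc_algebra n) (sym_torus n)"
  unfolding closed_boundary_def using closedin_sym_torus maximum_modulus_on_torus by simp

section \<open>Minimality of the symmetrized torus\<close>

text \<open>
  Suppose that \<open>|F|\<close> attains its maximum 1 only on a set \<open>E\<close> that contains \<open>p\<close>, and that \<open>L\<close> vanishes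
  on \<open>E\<close> except at \<open>p\<close>. Off a neighbourhood of \<open>E\<close> high powers of \<open>F\<close> make \<open>F\<^sup>M L\<close> small,
  near the other points of \<open>E\<close> the factor \<open>L\<close> is small, and at \<open>p\<close> the modulus remains \<open>|L p|\<close>.
  So every closed boundary comes close to \<open>p\<close>, hence contains it.
\<close>

lemma relative_peak_point_in_closed_boundary:
  assumes X: "compact_space X" and K: "closed_boundary X A K"
    and F: "continuous_map X euclidean F" "\<And>x. x \<in> topspace X \<Longrightarrow> cmod (F x) \<le> 1"
    and p: "p \<in> topspace X" "cmod (F p) = 1"
    and L: "continuous_map X euclidean L" "L p \<noteq> 0"
      "\<And>q. \<lbrakk>q \<in> topspace X; cmod (F q) = 1; q \<noteq> p\<rbrakk> \<Longrightarrow> L q = 0"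
    and A: "\<And>M. (\<lambda>x. F x ^ M * L x) \<in> A"
  shows "p \<in> K"
proof (rule ccontr)
  assume "p \<notin> K"
  have KX: "closedin X K" using K by (simp add: closed_boundary_def)
  then have K_sub: "K \<subseteq> topspace X" by (rule closedin_subset)
  have max: "\<exists>k\<in>K. cmod (L p) \<le> cmod (F k) ^ M * cmod (L k)" for M
  proof -
    have "\<exists>k\<in>K. cmod (F p ^ M * L p) \<le> cmod (F k ^ M * L k)"
      using bspec[OF bspec[OF conjunct2[OF K[unfolded closed_boundary_def]] A[of M]] p(1)] .
    then show ?thesis by (simp add: norm_mult norm_power p(2))
  qed
  \<comment> \<open>On \<open>K\<close> outside \<open>K'\<close> the modulus of \<open>F\<^sup>M L\<close> is below \<open>|L p|\<close> for every \<open>M\<close>; on the compact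
    set \<open>K'\<close> the modulus of \<open>F\<close> stays below 1.\<close>
  define K' where "K' = {x \<in> K. L x \<in> {y. cmod (L p) \<le> cmod y}}"
  have "closed {y. cmod (L p) \<le> cmod y}" by (intro closed_Collect_le continuous_intros)
  then have "closedin X K'"
    unfolding K'_def by (intro closedin_continuous_map_preimage_gen[OF L(1) KX]) simp
  then have "compactin X K'" by (rule closedin_compact_space[OF X])
  moreover have "K' \<noteq> {}" using max[of 0] by (auto simp: K'_def)
  ultimately obtain k0 where k0: "k0 \<in> K'" "\<And>k. k \<in> K' \<Longrightarrow> cmod (F k) \<le> cmod (F k0)"
    using norm_attains_max_on_compactin[OF _ _ F(1)] by blast
  obtain b where b: "b \<in> topspace X" "\<And>x. x \<in> topspace X \<Longrightarrow> cmod (L x) \<le> cmod (L b)"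
    using norm_attains_max_on_compactin[OF X[unfolded compact_space_def] _ L(1)] p(1) by blast
  have Lb: "cmod (L b) > 0" using b(2)[OF p(1)] L(2) by (smt (verit) zero_less_norm_iff)
  have "k0 \<in> topspace X" "k0 \<noteq> p" "L k0 \<noteq> 0"
    using k0(1) K_sub \<open>p \<notin> K\<close> L(2) by (auto simp: K'_def)
  then have "cmod (F k0) < 1"
    using F(2)[of k0] L(3)[of k0] by fastforce
  then obtain M where M: "cmod (F k0) ^ M < cmod (L p) / cmod (L b)"
    using real_arch_pow_inv[of "cmod (L p) / cmod (L b)" "cmod (F k0)"] Lb L(2) by auto
  obtain k where k: "k \<in> K" "cmod (L p) \<le> cmod (F k) ^ M * cmod (L k)" using max by blast
  have kX: "k \<in> topspace X" using k(1) K_sub by blast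
  have "cmod (F k) ^ M * cmod (L k) \<le> 1 * cmod (L k)"
    using F(2)[OF kX] by (intro mult_right_mono power_le_one) auto
  then have "k \<in> K'" using k by (simp add: K'_def)
  then have "cmod (F k) ^ M * cmod (L k) \<le> cmod (F k0) ^ M * cmod (L b)"
    using k0(2) b(2)[OF kX] by (intro mult_mono power_mono) auto
  also have "\<dots> < cmod (L p)" using M Lb by (simp add: pos_less_divide_eq)
  finally show False using k(2) by simp
qed

text \<open>
  One linear factor for each point \<open>q\<close> other than \<open>p\<close>, in a coordinate where \<open>p\<close> and \<open>q\<close> differ.
\<close>

lemma Cn_entire_separating:
  assumes "finite E" "E \<subseteq> extensional {1..n}" "p \<in> extensional {1..n}"
  obtains L where "Cn_entire n L" "L p \<noteq> 0" "\<And>q. q \<in> E - {p} \<Longrightarrow> L q = 0"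
proof -
  have "\<exists>i. i \<in> {1..n} \<and> p i \<noteq> q i" if "q \<in> E - {p}" for q
    using that assms(2,3) extensionalityI[of p "{1..n}" q] by blast
  then obtain i where i: "\<And>q. q \<in> E - {p} \<Longrightarrow> i q \<in> {1..n} \<and> p (i q) \<noteq> q (i q)" by metis
  show ?thesis
  proof (rule that[of "\<lambda>w. \<Prod>q\<in>E - {p}. w (i q) + - q (i q)"])
    show "Cn_entire n (\<lambda>w. \<Prod>q\<in>E - {p}. w (i q) + - q (i q))"
      using i by (intro Cn_entire_prod Cn_entire_add Cn_entire_coord Cn_entire_const) auto
    show "(\<Prod>q\<in>E - {p}. p (i q) + - q (i q)) \<noteq> 0"
      using i assms(1) by auto
    show "(\<Prod>q\<in>E - {p}. r (i q) + - q (i q)) = 0" if "r \<in> E - {p}" for r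
      using that assms(1) by (intro prod_zero bexI[of _ r]) auto
  qed
qed

text \<open>
  The symmetric function \<open>\<Prod>\<^sub>j (z\<^sub>j\<^sup>N + 1)\<close> is a polynomial in the elementary symmetric functions
  for an elementary reason: if \<open>a\<^sub>1, \<dots>, a\<^sub>N\<close> are the roots of
  \<open>x\<^sup>N + 1\<close>, then up to sign it is \<open>\<Prod>\<^sub>l \<Prod>\<^sub>j (a\<^sub>l - z\<^sub>j)\<close>, and each inner product is
  the root polynomial at \<open>a\<^sub>l\<close>, which is affine in the coordinates.
\<close>

lemma root_of_unity_peak:
  assumes "N \<ge> 1"
  obtains F where "Cn_entire n F"
    "\<And>z. cmod (F (symmetrization n z)) = (\<Prod>j\<in>{1..n}. cmod (z j ^ N + 1) / 2)"
proof -
  define s :: "nat \<Rightarrow> complex" where "s i = (if i = N then (- 1) ^ N else 0)" for i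
  have "(\<Sum>i=1..N. (- 1) ^ i * s i * x ^ (N - i)) = 1" for x
  proof -
    have "(\<Sum>i=1..N. (- 1) ^ i * s i * x ^ (N - i)) = (\<Sum>i=1..N. if N = i then 1 else 0)"
      by (intro sum.cong refl) (auto simp: s_def power_mult_distrib[symmetric])
    then show ?thesis using assms by simp
  qed
  then have root: "root_poly N s x = x ^ N + 1" for x by (simp add: root_poly_def)
  obtain a where a: "\<And>x :: complex. x ^ N + 1 = (\<Prod>l\<in>{1..N}. x - a l)"
    using root_poly_splits[of N s] unfolding root by metis
  show ?thesis
  proof (rule that[of "\<lambda>w. (\<Prod>l\<in>{1..N}. root_poly n w (a l)) * (1 / 2 ^ n)"])
    show "Cn_entire n (\<lambda>w. (\<Prod>l\<in>{1..N}. root_poly n w (a l)) * (1 / 2 ^ n))"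
      by (rule Cn_entire_mult[OF Cn_entire_prod[OF Cn_entire_root_poly] Cn_entire_const])
    fix z
    have "cmod (\<Prod>l\<in>{1..N}. root_poly n (symmetrization n z) (a l))
        = (\<Prod>l\<in>{1..N}. \<Prod>j\<in>{1..n}. cmod (z j - a l))"
      unfolding root_poly_symmetrization prod_norm[symmetric] by (simp add: norm_minus_commute)
    also have "\<dots> = (\<Prod>j\<in>{1..n}. cmod (z j ^ N + 1))"
      unfolding a prod_norm[symmetric] by (rule prod.swap)
    finally show "cmod ((\<Prod>l\<in>{1..N}. root_poly n (symmetrization n z) (a l)) * (1 / 2 ^ n))
        = (\<Prod>j\<in>{1..n}. cmod (z j ^ N + 1) / 2)"
      by (simp add: norm_mult norm_divide norm_power prod_dividef)
  qed
qed

lemma peak_at_one: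
  assumes "cmod u \<le> 1"
  shows "cmod (u + 1) \<le> 2" and "cmod (u + 1) = 2 \<Longrightarrow> u = 1"
proof -
  show "cmod (u + 1) \<le> 2" using norm_triangle_ineq[of u 1] assms by simp
  assume "cmod (u + 1) = 2"
  moreover have "(cmod u)\<^sup>2 \<le> 1" using assms by (simp add: power_le_one)
  moreover have "(cmod (u + 1))\<^sup>2 = (cmod u)\<^sup>2 + 2 * Re u + 1"
    unfolding cmod_power2 by (simp add: algebra_simps power2_eq_square)
  ultimately have "Re u \<ge> 1" by simp
  moreover have "Re u \<le> 1" using complex_Re_le_cmod[of u] assms by simp
  ultimately have "Re u = 1" by simp
  moreover from this have "Im u = 0"
    using \<open>(cmod u)\<^sup>2 \<le> 1\<close> unfolding cmod_power2 by simp
  ultimately show "u = 1" by (simp add: complex_eq_iff)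
qed

text \<open>
  The peak function for exponent \<open>N\<close> has modulus 1 exactly at the points that come from tuples of \<open>N\<close>-th
  roots of unity. There are finitely many of these, and a polynomial separates one from the others.
\<close>

lemma root_of_unity_point_in_closed_boundary:
  assumes K: "closed_boundary (sym_disc_space n) (sym_disc_algebra n) K"
    and N: "N \<ge> 1" and t: "t \<in> {1..n} \<rightarrow>\<^sub>E {u. u ^ N = 1}"
  shows "symmetrization n t \<in> K"
proof -
  define E where "E = symmetrization n ` ({1..n} \<rightarrow>\<^sub>E {u. u ^ N = 1})"
  have "finite {u :: complex. u ^ N = 1}" using N by (rule finite_roots_unity)
  then have "finite E" by (auto simp: E_def intro!: finite_PiE)
  have E_ext: "E \<subseteq> extensional {1..n}" by (auto simp: E_def symmetrization_def)
  obtain F where F: "Cn_entire n F"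
    "\<And>z. cmod (F (symmetrization n z)) = (\<Prod>j\<in>{1..n}. cmod (z j ^ N + 1) / 2)"
    using root_of_unity_peak[OF N] by blast
  have factor: "cmod (z j ^ N + 1) / 2 \<le> 1" if "z \<in> {1..n} \<rightarrow>\<^sub>E cball 0 1" "j \<in> {1..n}" for z j
    using peak_at_one(1)[of "z j ^ N"] that by (auto simp: PiE_iff norm_power power_le_one)
  have F_le: "cmod (F x) \<le> 1" if "x \<in> sym_disc n" for x
    using that factor by (auto simp: sym_disc_def F(2) intro!: prod_le_1)
  have F_peak: "x \<in> E" if x: "x \<in> sym_disc n" "cmod (F x) = 1" for x
  proof -
    obtain z where z: "z \<in> {1..n} \<rightarrow>\<^sub>E cball 0 1" "x = symmetrization n z"
      using x(1) by (auto simp: sym_disc_def)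
    have "z j ^ N = 1" if j: "j \<in> {1..n}" for j
    proof -
      have "1 = cmod (z j ^ N + 1) / 2 * (\<Prod>k\<in>{1..n} - {j}. cmod (z k ^ N + 1) / 2)"
        using x(2) unfolding z(2) F(2) by (subst (asm) prod.remove[OF _ j]) auto
      also have "\<dots> \<le> cmod (z j ^ N + 1) / 2 * 1"
        using factor[OF z(1)] by (intro mult_left_mono prod_le_1) auto
      finally have "cmod (z j ^ N + 1) = 2" using factor[OF z(1) j] by simp
      moreover have "cmod (z j ^ N) \<le> 1"
        using z(1) j by (auto simp: PiE_iff norm_power power_le_one)
      ultimately show ?thesis using peak_at_one(2) by blast
    qed
    then have "z \<in> {1..n} \<rightarrow>\<^sub>E {u. u ^ N = 1}" using z(1) by (auto simp: PiE_iff)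
    then show ?thesis using z(2) by (simp add: E_def)
  qed
  have "cmod u = 1" if "u ^ N = 1" for u :: complex
    using that N power_eq_imp_eq_base[of "cmod u" N 1] by (simp flip: norm_power)
  then have "t \<in> {1..n} \<rightarrow>\<^sub>E cball 0 1" using t by (auto simp: PiE_iff)
  then have p: "symmetrization n t \<in> sym_disc n" by (simp add: sym_disc_def)
  have "cmod (F (symmetrization n t)) = 1"
    unfolding F(2) using t by (intro prod.neutral) (auto simp: PiE_iff)
  obtain L where L: "Cn_entire n L" "L (symmetrization n t) \<noteq> 0"
    "\<And>q. q \<in> E - {symmetrization n t} \<Longrightarrow> L q = 0"
    using Cn_entire_separating[OF \<open>finite E\<close> E_ext symmetrization_extensional] by metis
  show ?thesis
  proof (rule relative_peak_point_in_closed_boundary[OF compact_sym_disc_space K, of F _ L])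
    show "continuous_map (sym_disc_space n) euclidean F"
      using F(1) by (simp add: Cn_entire_def continuous_map_from_subtopology)
    show "continuous_map (sym_disc_space n) euclidean L"
      using L(1) by (simp add: Cn_entire_def continuous_map_from_subtopology)
    show "(\<lambda>x. F x ^ M * L x) \<in> sym_disc_algebra n" for M
      using F(1) L(1) by (intro Cn_entire_in_algebra Cn_entire_mult Cn_entire_power)
    show "cmod (F x) \<le> 1" if "x \<in> topspace (sym_disc_space n)" for x
      using that F_le by (simp only: topspace_sym_disc_space)
    show "symmetrization n t \<in> topspace (sym_disc_space n)"
      using p by (simp only: topspace_sym_disc_space)
    show "L q = 0"
      if "q \<in> topspace (sym_disc_space n)" "cmod (F q) = 1" "q \<noteq> symmetrization n t" for q
      using that F_peak L(3) by (simp only: topspace_sym_disc_space) blast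
  qed fact+
qed

text \<open>
  Round the argument of \<open>t\<close>, measured in full turns, down to a multiple of \<open>1 / (N + 1)\<close>.
\<close>

lemma roots_of_unity_dense:
  assumes "cmod t = 1"
  obtains u where "\<And>N. u N ^ Suc N = 1" "u \<longlonglongrightarrow> t"
proof -
  define \<theta> where "\<theta> = Arg t"
  have "t \<noteq> 0" using assms by auto
  then have \<theta>: "cis \<theta> = t" using cis_Arg assms by (simp add: sgn_eq \<theta>_def)
  define c where "c = \<theta> / (2 * pi)"
  define r where "r N = real_of_int \<lfloor>real (Suc N) * c\<rfloor> / real (Suc N)" for N
  have "r \<longlonglongrightarrow> c"
  proof (rule LIM_zero_cancel, rule Lim_null_comparison)
    have "\<bar>r N - c\<bar> \<le> inverse (real (Suc N))" for N
    proof -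
      have "\<bar>real_of_int \<lfloor>y\<rfloor> - y\<bar> \<le> 1" for y :: real by linarith
      then have "\<bar>real_of_int \<lfloor>real (Suc N) * c\<rfloor> - real (Suc N) * c\<bar> \<le> 1" by blast
      moreover have "r N - c = (real_of_int \<lfloor>real (Suc N) * c\<rfloor> - real (Suc N) * c) / real (Suc N)"
        unfolding r_def diff_divide_distrib by simp
      ultimately have "\<bar>r N - c\<bar> \<le> 1 / \<bar>real (Suc N)\<bar>"
        by (simp only: abs_divide divide_right_mono abs_ge_zero)
      then show ?thesis by (simp only: inverse_eq_divide abs_of_nat)
    qed
    then show "\<forall>\<^sub>F N in sequentially. norm (r N - c) \<le> inverse (real (Suc N))" by simp
    show "(\<lambda>N. inverse (real (Suc N))) \<longlonglongrightarrow> 0" by (rule LIMSEQ_inverse_real_of_nat)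
  qed
  show ?thesis
  proof (rule that[of "\<lambda>N. cis (2 * pi * r N)"])
    show "cis (2 * pi * r N) ^ Suc N = 1" for N
    proof -
      have "real (Suc N) * (2 * pi * r N) = 2 * pi * real_of_int \<lfloor>real (Suc N) * c\<rfloor>"
        by (simp add: r_def del: of_nat_Suc)
      then have "cis (2 * pi * r N) ^ Suc N = cis (2 * pi * real_of_int \<lfloor>real (Suc N) * c\<rfloor>)"
        by (simp only: Complex.DeMoivre)
      also have "\<dots> = 1" by (rule cis_multiple_2pi) simp
      finally show ?thesis .
    qed
    have "(\<lambda>N. cis (2 * pi * r N)) \<longlonglongrightarrow> cis (2 * pi * c)"
      unfolding cis_conv_exp by (intro tendsto_intros \<open>r \<longlonglongrightarrow> c\<close>)
    then show "(\<lambda>N. cis (2 * pi * r N)) \<longlonglongrightarrow> t"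
      by (simp add: \<theta> c_def)
  qed
qed

text \<open>
  Tuples of roots of unity of a common order are dense in the torus, and a closed boundary is closed.
\<close>

lemma sym_torus_subset_closed_boundary:
  assumes K: "closed_boundary (sym_disc_space n) (sym_disc_algebra n) K"
  shows "sym_torus n \<subseteq> K"
proof
  fix p assume "p \<in> sym_torus n"
  then obtain t where t: "t \<in> {1..n} \<rightarrow>\<^sub>E sphere 0 1" "p = symmetrization n t"
    by (auto simp: sym_torus_def)
  have "\<exists>u. (\<forall>N. u N ^ Suc N = 1) \<and> u \<longlonglongrightarrow> t j" if "j \<in> {1..n}" for j
    using roots_of_unity_dense[of "t j"] t(1) that by (metis PiE_mem mem_sphere_0)
  then obtain u where u: "\<And>j N. j \<in> {1..n} \<Longrightarrow> u j N ^ Suc N = 1"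
    "\<And>j. j \<in> {1..n} \<Longrightarrow> u j \<longlonglongrightarrow> t j" by metis
  define v where "v N = (\<lambda>j\<in>{1..n}. u j N)" for N
  have "limitin (Cn_topology n) v t sequentially"
    unfolding Cn_topology_def limitin_componentwise
    using t(1) u(2) by (auto simp: v_def PiE_iff)
  then have "limitin (Cn_topology n) (symmetrization n \<circ> v) p sequentially"
    unfolding t(2) by (rule continuous_map_limit[OF continuous_map_symmetrization])
  moreover have vK: "symmetrization n (v N) \<in> K" for N
    using u(1) by (intro root_of_unity_point_in_closed_boundary[OF K, of "Suc N"]) (auto simp: v_def)
  moreover have KX: "closedin (sym_disc_space n) K" using K by (simp add: closed_boundary_def)
  then have "K \<subseteq> sym_disc n" using closedin_subset by fastforce
  ultimately have "limitin (sym_disc_space n) (symmetrization n \<circ> v) p sequentially"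
    using sym_torus_subset \<open>p \<in> sym_torus n\<close> 
    by (auto simp: limitin_subtopology intro!: always_eventually)
  then show "p \<in> K"
    by (rule limitin_closedin[OF _ KX]) (use vK in auto)
qed

section \<open>The characterization of the distinguished boundary\<close>

lemma sym_disc_boundary_eq_sym_torus: "sym_disc_boundary n = sym_torus n"
  unfolding sym_disc_boundary_def shilov_boundary_def
proof (rule Least_equality)
  show "closed_boundary (sym_disc_space n) (sym_disc_algebra n) (sym_torus n)"
    by (rule closed_boundary_sym_torus)
qed (rule sym_torus_subset_closed_boundary)

theorem theorem2p4:
  fixes n :: nat and s :: "nat \<Rightarrow> complex"
  assumes "n \<ge> 2"
  shows "((\<lambda>i\<in>{1..n}. s i) \<in> sym_disc_boundary n \<longleftrightarrow>
            cmod (s n) = 1 \<and>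
            (\<forall>i\<in>{1..n-1}. cnj (s n) * s i = cnj (s (n - i))) \<and>
            (\<lambda>i\<in>{1..n-1}. (of_nat (n - i) / of_nat n) * s i) \<in> sym_disc (n - 1))
       \<and> ((\<lambda>i\<in>{1..n}. s i) \<in> sym_disc_boundary n \<longleftrightarrow>
            (\<lambda>i\<in>{1..n}. s i) \<in> sym_disc n \<and> cmod (s n) = 1)"
proof -
  have "n \<ge> 1" using assms by simp
  show ?thesis
    unfolding sym_disc_boundary_eq_sym_torus
    using sym_torus_iff_derived[OF \<open>n \<ge> 1\<close>, of s, unfolded derived_def]
      sym_torus_iff_sym_disc[OF \<open>n \<ge> 1\<close>, of s]
    by (rule conjI)
qed

end
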